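(* Let $T$ be a spherically homogeneous rooted tree in which every vertex has at least $2$ children, and let $G\le \mathrm{Aut}~T$ be a finitely generated branch group. Then $G$ does not have the local retraction property $\mathrm{(LR)}$.
   Context: $\mathrm{Aut}~T$ is the group of automorphisms of $T$ fixing the root. The $n$th level $\mathcal{L}_n$ is the set of vertices at distance $n$ from the root. For a vertex $v$, $T_v$ is the subtree of descendants of $v$ (including $v$). For $G\le\mathrm{Aut}~T$, the rigid vertex stabilizer $\mathrm{rist}_G(v)$ is the subgroup of elements of $G$ fixing every vertex not in $T_v$, and the rigid level stabilizer is $\mathrm{Rist}_G(n)=\prod_{v\in\mathcal{L}_n}\mathrm{rist}_G(v)$ (an internal direct product). $G$ is level-transitive if it acts transitively on every level $\mathcal{L}_n$. $G$ is branch if it is level-transitive and $\mathrm{Rist}_G(n)$ has finite index in $G$ for every $n\ge1$. A subgroup $H\le G$ is a virtual retract of $G$ if there is a finite-index subgroup $K\le G$ containing $H$ and a homomorphism $K\to H$ restricting to the identity on $H$. $G$ has property $\mathrm{(LR)}$ if every finitely generated subgroup of $G$ is a virtual retract of $G$. *)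

theory Defs
  imports "HOL-Algebra.Algebra"
begin

text \<open>Spherically homogeneous rooted tree with branching sequence m:
  vertices are finite words v with v!i < m i; the root is the empty word;
  the parent of u@[a] is u.\<close>

definition verts :: "(nat \<Rightarrow> nat) \<Rightarrow> nat list set" where
  "verts m = {v. \<forall>i<length v. v ! i < m i}"

definition level :: "(nat \<Rightarrow> nat) \<Rightarrow> nat \<Rightarrow> nat list set" where
  "level m n = {v \<in> verts m. length v = n}"

definition adjacent :: "nat list \<Rightarrow> nat list \<Rightarrow> bool" where
  "adjacent u w \<longleftrightarrow> (\<exists>a. w = u @ [a] \<or> u = w @ [a])"

definition subtree :: "(nat \<Rightarrow> nat) \<Rightarrow> nat list \<Rightarrow> nat list set" where
  "subtree m v = {w \<in> verts m. (\<exists>u. w = v @ u)}"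

definition tree_aut :: "(nat \<Rightarrow> nat) \<Rightarrow> (nat list \<Rightarrow> nat list) set" where
  "tree_aut m = {g. bij_betw g (verts m) (verts m) \<and> g [] = []
      \<and> (\<forall>u\<in>verts m. \<forall>w\<in>verts m. adjacent u w \<longleftrightarrow> adjacent (g u) (g w))
      \<and> (\<forall>x. x \<notin> verts m \<longrightarrow> g x = x)}"

definition AutT :: "(nat \<Rightarrow> nat) \<Rightarrow> (nat list \<Rightarrow> nat list) monoid" where
  "AutT m = \<lparr>carrier = tree_aut m, monoid.mult = (\<lambda>g h. g \<circ> h), one = id\<rparr>"

definition rist :: "(nat \<Rightarrow> nat) \<Rightarrow> (nat list \<Rightarrow> nat list) set \<Rightarrow> nat list \<Rightarrow> (nat list \<Rightarrow> nat list) set" where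
  "rist m G v = {g \<in> G. \<forall>w\<in>verts m. w \<notin> subtree m v \<longrightarrow> g w = w}"

text \<open>Rigid level stabilizer: the (internal direct) product of the rist's of the
  vertices of level n, i.e. the subgroup they generate.\<close>
definition Rist :: "(nat \<Rightarrow> nat) \<Rightarrow> (nat list \<Rightarrow> nat list) set \<Rightarrow> nat \<Rightarrow> (nat list \<Rightarrow> nat list) set" where
  "Rist m G n = generate (AutT m) (\<Union>v\<in>level m n. rist m G v)"

definition finite_index :: "(nat \<Rightarrow> nat) \<Rightarrow> (nat list \<Rightarrow> nat list) set \<Rightarrow> (nat list \<Rightarrow> nat list) set \<Rightarrow> bool" where
  "finite_index m K G \<longleftrightarrow> subgroup K ((AutT m)\<lparr>carrier := G\<rparr>)
      \<and> finite (rcosets\<^bsub>(AutT m)\<lparr>carrier := G\<rparr>\<^esub> K)"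

definition level_transitive :: "(nat \<Rightarrow> nat) \<Rightarrow> (nat list \<Rightarrow> nat list) set \<Rightarrow> bool" where
  "level_transitive m G \<longleftrightarrow> (\<forall>n. \<forall>u\<in>level m n. \<forall>w\<in>level m n. \<exists>g\<in>G. g u = w)"

definition branch :: "(nat \<Rightarrow> nat) \<Rightarrow> (nat list \<Rightarrow> nat list) set \<Rightarrow> bool" where
  "branch m G \<longleftrightarrow> subgroup G (AutT m) \<and> level_transitive m G
      \<and> (\<forall>n\<ge>1. finite_index m (Rist m G n) G)"

definition fin_gen :: "(nat \<Rightarrow> nat) \<Rightarrow> (nat list \<Rightarrow> nat list) set \<Rightarrow> bool" where
  "fin_gen m H \<longleftrightarrow> (\<exists>S. finite S \<and> S \<subseteq> H \<and> generate (AutT m) S = H)"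

definition virtual_retract :: "(nat \<Rightarrow> nat) \<Rightarrow> (nat list \<Rightarrow> nat list) set \<Rightarrow> (nat list \<Rightarrow> nat list) set \<Rightarrow> bool" where
  "virtual_retract m H G \<longleftrightarrow> (\<exists>K r. finite_index m K G \<and> H \<subseteq> K
      \<and> r \<in> hom ((AutT m)\<lparr>carrier := K\<rparr>) ((AutT m)\<lparr>carrier := H\<rparr>)
      \<and> (\<forall>h\<in>H. r h = h))"

definition LR :: "(nat \<Rightarrow> nat) \<Rightarrow> (nat list \<Rightarrow> nat list) set \<Rightarrow> bool" where
  "LR m G \<longleftrightarrow> (\<forall>H. subgroup H ((AutT m)\<lparr>carrier := G\<rparr>) \<and> fin_gen m H
      \<longrightarrow> virtual_retract m H G)"

end

theory Submission
  imports Defs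
begin

text \<open>
  Suppose that \<open>G\<close> has (LR). Rigid stabilizers \<open>rist(v)\<close> of non-root vertices are finitely generated
  (Schreier, then projection of \<open>Rist(n)\<close>), and a finite-index subgroup \<open>K\<close> of \<open>G\<close> meets each
  \<open>rist(u)\<close> in a group with trivial centre.

  Let \<open>s \<noteq> 1\<close> lie in \<open>rist(v)\<close> and let \<open>r : K \<rightarrow> \<langle>s\<rangle>\<close> be a virtual retraction. Put
  \<open>A = K \<inter> rist(v)\<close> and let \<open>A'\<close> be a conjugate of \<open>A\<close> below another vertex of the same level.
  The fibre product \<open>Q\<close> of \<open>A\<close> and \<open>A'\<close> over \<open>r\<close> is finitely generated, normal in \<open>A \<times> A'\<close>, and
  has trivial centralizer there. The kernel of a retraction onto \<open>Q\<close> centralizes \<open>Q\<close> within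
  \<open>A \<times> A'\<close>, so the retraction is the identity on its domain intersected with \<open>A \<times> A'\<close>, and some
  power of \<open>s\<close> lies in \<open>Q\<close>. Hence \<open>s\<close> has finite order.

  So \<open>G\<close> contains \<open>t\<close> of prime order \<open>p\<close>, moving a vertex \<open>v\<close> say. Let \<open>D\<close> be the diagonal copy of
  \<open>rist(v)\<close> in the product of its conjugates by powers of \<open>t\<close>, and retract \<open>K\<close> onto \<open>H = \<langle>D, t\<rangle>\<close>
  with kernel \<open>N\<close>. If \<open>N\<close> moved some \<open>u\<close> below \<open>v\<close>, it would contain all commutators of
  \<open>K \<inter> rist(u)\<close> and their conjugates by \<open>t\<close>, hence meet \<open>D\<close> nontrivially. So \<open>N\<close> is trivial below
  the \<open>t\<close>-orbit of \<open>v\<close>; but then \<open>K \<inter> rist(v)\<close> embeds in \<open>D\<close> there, which is absurd.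
\<close>

section \<open>Finite-index subgroups\<close>

text \<open>Schreier's lemma. The set \<open>M\<close> of products of an element of the generated
  subgroup with one of \<open>U\<close> contains \<open>\<one>\<close> and is stable under right
  multiplication by the generators of \<open>H\<close> and their inverses, so it contains
  \<open>H\<close>.\<close>

lemma (in group) finite_index_fin_gen:
  assumes K: "subgroup K G" "K \<subseteq> H" and S: "finite S" "S \<subseteq> carrier G" "generate G S = H"
    and T: "finite T" "T \<subseteq> H" "H \<subseteq> K <#> T"
  shows "\<exists>S'. finite S' \<and> S' \<subseteq> K \<and> generate G S' = K"
proof -
  have H: "subgroup H G"
    using generate_is_subgroup[OF S(2)] S(3) by simp
  have Kc: "K \<subseteq> carrier G" and Hc: "H \<subseteq> carrier G" and Tc: "T \<subseteq> carrier G"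
    using K(1) H T(2) by (auto dest: subgroup.subset)
  define U where "U = insert \<one> T"
  have U: "finite U" "U \<subseteq> H" "U \<subseteq> carrier G"
    using T H Tc by (auto simp: U_def subgroup.one_closed)
  \<comment> \<open>All elements \<open>t \<otimes> s \<otimes> inv t'\<close> are formed and those
    outside \<open>K\<close> are dropped afterwards, so no coset representative has to be singled
    out. Allowing \<open>s = \<one>\<close> puts \<open>U \<inter> K\<close> among them, which
    absorbs the last factor when an element of \<open>K\<close> is written as a member of
    \<open>M\<close>.\<close>
  define Gs where "Gs = (\<lambda>(t, s, t'). t \<otimes> s \<otimes> inv t') ` (U \<times> (insert \<one> (S \<union> m_inv G ` S)) \<times> U)"
  define S' where "S' = K \<inter> Gs"
  have fin: "finite S'" using U S by (simp add: S'_def Gs_def)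
  have S'c: "S' \<subseteq> carrier G" using Kc by (auto simp: S'_def)
  have gK: "generate G S' \<subseteq> K"
    using generate_subgroup_incl[OF _ K(1)] by (simp add: S'_def)
  have sub: "subgroup (generate G S') G" by (rule generate_is_subgroup[OF S'c])
  define M where "M = generate G S' <#> U"
  have step: "x \<otimes> s \<in> M" if x: "x \<in> M" and s: "s \<in> S \<union> m_inv G ` S" for x s
  proof -
    obtain y t where yt: "y \<in> generate G S'" "t \<in> U" "x = y \<otimes> t"
      using x by (auto simp: M_def set_mult_def)
    have sH: "s \<in> H"
      using s S(3) generate.incl[of _ S G] generate.inv[of _ S G] by auto
    have "t \<otimes> s \<in> K <#> T"
      using T(3) subgroup.m_closed[OF H] yt(2) U sH by blast
    then obtain k t' where k: "k \<in> K" "t' \<in> T" "t \<otimes> s = k \<otimes> t'"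
      by (auto simp: set_mult_def)
    have c: "t \<in> carrier G" "s \<in> carrier G" "k \<in> carrier G" "t' \<in> carrier G" "y \<in> carrier G"
      using yt U sH Hc k Kc Tc gK by auto
    have "k = t \<otimes> s \<otimes> inv t'" using k(3) c by (simp add: m_assoc)
    moreover have "(t, s, t') \<in> U \<times> insert \<one> (S \<union> m_inv G ` S) \<times> U"
      using yt(2) s k(2) by (auto simp: U_def)
    ultimately have "k \<in> Gs" unfolding Gs_def by force
    then have "k \<in> generate G S'" using k(1) by (auto simp: S'_def intro: generate.incl)
    then have "y \<otimes> k \<in> generate G S'" using yt(1) subgroup.m_closed[OF sub] by blast
    moreover have "x \<otimes> s = (y \<otimes> k) \<otimes> t'" using k(3) c yt(3) by (simp add: m_assoc)
    ultimately show ?thesis using k(2) by (auto simp: M_def set_mult_def U_def)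
  qed
  have Mc: "M \<subseteq> carrier G"
    using gK Kc U(3) by (auto simp: M_def set_mult_def subset_iff)
  have closed: "x \<otimes> h \<in> M" if "h \<in> generate G S" "x \<in> M" for h x
    using that
  proof (induction arbitrary: x)
    case one then show ?case using Mc by auto
  next
    case (incl h) then show ?case using step by blast
  next
    case (inv h) then show ?case using step by blast
  next
    case (eng h1 h2)
    have "h1 \<in> carrier G" "h2 \<in> carrier G" "x \<in> carrier G"
      using eng S Hc Mc by auto
    then have "x \<otimes> (h1 \<otimes> h2) = (x \<otimes> h1) \<otimes> h2" by (simp add: m_assoc)
    then show ?case using eng by simp
  qed
  have "\<one> \<otimes> \<one> \<in> M" unfolding M_def set_mult_def
    unfolding U_def using generate.one[of G S'] by blast
  then have one: "\<one> \<in> M" by simp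
  have "K \<subseteq> generate G S'"
  proof
    fix k assume k: "k \<in> K"
    then have "\<one> \<otimes> k \<in> M" using closed[OF _ one] K(2) S(3) by auto
    then have "k \<in> M" using k Kc by auto
    then obtain y t where yt: "y \<in> generate G S'" "t \<in> U" "k = y \<otimes> t"
      by (auto simp: M_def set_mult_def)
    have c: "y \<in> carrier G" "t \<in> carrier G" using yt gK Kc U by auto
    have "t = inv y \<otimes> k" using yt(3) c by (simp add: m_assoc[symmetric])
    then have tK: "t \<in> K"
      using subgroup.m_closed[OF K(1)] subgroup.m_inv_closed[OF K(1)] yt(1) gK k by auto
    have "t = t \<otimes> \<one> \<otimes> inv \<one>" using c by simp
    moreover have "(t, \<one>, \<one>) \<in> U \<times> insert \<one> (S \<union> m_inv G ` S) \<times> U"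
      using yt(2) by (auto simp: U_def)
    ultimately have "t \<in> Gs" unfolding Gs_def by force
    then have "t \<in> generate G S'" using tK by (auto simp: S'_def intro: generate.incl)
    then show "k \<in> generate G S'" using yt subgroup.m_closed[OF sub] by auto
  qed
  then show ?thesis using fin gK by (auto simp: S'_def)
qed

lemma (in group) finite_rcosets_transversal:
  assumes H: "subgroup H G" and K: "subgroup K (G\<lparr>carrier := H\<rparr>)"
    and fin: "finite (rcosets\<^bsub>G\<lparr>carrier := H\<rparr>\<^esub> K)"
  shows "\<exists>T. finite T \<and> T \<subseteq> H \<and> H \<subseteq> K <#> T"
proof -
  interpret H: group "G\<lparr>carrier := H\<rparr>" using subgroup.subgroup_is_group[OF H is_group] .
  have KH: "K \<subseteq> H" using subgroup.subset[OF K] by simp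
  have Hc: "H \<subseteq> carrier G" using subgroup.subset[OF H] .
  have KG: "subgroup K G" using incl_subgroup[OF H K] .
  define T where "T = (\<lambda>C. SOME t. t \<in> H \<and> C = K #> t) ` (rcosets\<^bsub>G\<lparr>carrier := H\<rparr>\<^esub> K)"
  have rc: "\<exists>t. t \<in> H \<and> C = K #> t" if "C \<in> rcosets\<^bsub>G\<lparr>carrier := H\<rparr>\<^esub> K" for C
    using that by (auto simp: RCOSETS_def r_coset_def)
  have "T \<subseteq> H" using someI_ex[OF rc] by (auto simp: T_def)
  moreover have "H \<subseteq> K <#> T"
  proof
    fix h assume h: "h \<in> H"
    have C: "K #> h \<in> rcosets\<^bsub>G\<lparr>carrier := H\<rparr>\<^esub> K"
      using h by (auto simp: RCOSETS_def r_coset_def)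
    define t where "t = (SOME t. t \<in> H \<and> K #> h = K #> t)"
    have t: "t \<in> H" "K #> h = K #> t" using someI_ex[OF rc[OF C]] by (auto simp: t_def)
    have "h \<in> K #> t" using rcos_self[OF _ KG] t h Hc by blast
    moreover have "t \<in> T" using C by (auto simp: T_def t_def)
    ultimately show "h \<in> K <#> T" by (auto simp: r_coset_def set_mult_def)
  qed
  ultimately show ?thesis using fin by (auto simp: T_def)
qed

text \<open>For each \<open>t\<close> whose coset of \<open>K\<close> meets \<open>L\<close>,
  \<open>T'\<close> takes one element of \<open>L\<close> from that coset; two elements of
  \<open>L\<close> in the same coset differ by an element of \<open>K \<inter> L\<close>.\<close>

lemma (in group) transversal_Int:
  assumes K: "subgroup K G" and L: "subgroup L G" "L \<subseteq> H"
    and T: "finite T" "T \<subseteq> carrier G" "H \<subseteq> K <#> T"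
  shows "\<exists>T'. finite T' \<and> T' \<subseteq> L \<and> L \<subseteq> (K \<inter> L) <#> T'"
proof -
  define T' where "T' = (\<lambda>t. SOME l. l \<in> L \<and> l \<otimes> inv t \<in> K) ` {t \<in> T. \<exists>l. l \<in> L \<and> l \<otimes> inv t \<in> K}"
  have sel: "(SOME l. l \<in> L \<and> l \<otimes> inv t \<in> K) \<in> L" "(SOME l. l \<in> L \<and> l \<otimes> inv t \<in> K) \<otimes> inv t \<in> K"
    if "\<exists>l. l \<in> L \<and> l \<otimes> inv t \<in> K" for t
    using someI_ex[OF that] by auto
  have "L \<subseteq> (K \<inter> L) <#> T'"
  proof
    fix l assume l: "l \<in> L"
    obtain k t where kt: "k \<in> K" "t \<in> T" "l = k \<otimes> t"
      using l L(2) T(3) by (force simp: set_mult_def)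
    have c: "k \<in> carrier G" "t \<in> carrier G" using kt T(2) subgroup.subset[OF K] by auto
    have "l \<otimes> inv t = k" using kt c by (simp add: m_assoc)
    then have ex: "\<exists>l. l \<in> L \<and> l \<otimes> inv t \<in> K" using l kt by auto
    define l' where "l' = (SOME l. l \<in> L \<and> l \<otimes> inv t \<in> K)"
    have l': "l' \<in> L" "l' \<otimes> inv t \<in> K" "l' \<in> T'"
      using sel[OF ex] ex kt(2) by (auto simp: l'_def T'_def)
    have l'c: "l' \<in> carrier G" "l \<in> carrier G" using l' l subgroup.subset[OF L(1)] by auto
    have "l \<otimes> inv l' = k \<otimes> inv (l' \<otimes> inv t)"
      using kt c l'c by (simp add: inv_mult_group m_assoc)
    then have "l \<otimes> inv l' \<in> K"
      using kt(1) l'(2) K by (simp add: subgroup.m_closed subgroup.m_inv_closed)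
    moreover have "l \<otimes> inv l' \<in> L"
      using l'(1) l L(1) by (simp add: subgroup.m_closed subgroup.m_inv_closed)
    moreover have "l = (l \<otimes> inv l') \<otimes> l'" using l'c by (simp add: m_assoc)
    ultimately show "l \<in> (K \<inter> L) <#> T'" using l'(3) unfolding set_mult_def by blast
  qed
  moreover have "finite T'" "T' \<subseteq> L" using T(1) sel by (auto simp: T'_def)
  ultimately show ?thesis by blast
qed

section \<open>Automorphisms of the tree\<close>

text \<open>Elements of \<open>tree_aut m\<close> fix every word outside \<open>verts m\<close>, so
  they are bijections of the whole type and their group inverse is the inverse function on
  \<open>UNIV\<close>.\<close>

abbreviation pinv :: "('a \<Rightarrow> 'a) \<Rightarrow> 'a \<Rightarrow> 'a" where
  "pinv f \<equiv> inv_into UNIV f"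

lemma pinv_right: "bij x \<Longrightarrow> x (pinv x w) = w"
  by (simp add: bij_is_surj surj_f_inv_f)

lemma pinv_left: "bij x \<Longrightarrow> pinv x (x w) = w"
  by (simp add: bij_is_inj)

lemma pinv_comp: "bij f \<Longrightarrow> bij g \<Longrightarrow> pinv (f \<circ> g) = pinv g \<circ> pinv f"
  by (rule o_inv_distrib)

lemma comp_pinv: "bij f \<Longrightarrow> f \<circ> pinv f = id" "bij f \<Longrightarrow> pinv f \<circ> f = id"
  by (auto simp: fun_eq_iff pinv_right pinv_left)

lemma pinv_comp_neq_id:
  assumes "bij x" "x \<noteq> y" shows "y \<circ> pinv x \<noteq> id"
proof
  assume "y \<circ> pinv x = id"
  then have "y (pinv x (x w)) = x w" for w by (metis comp_apply id_apply)
  then show False using assms by (auto simp: pinv_left)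
qed

lemma commute_if_commutator_eq_id:
  assumes "bij a" "bij b" "a \<circ> b \<circ> pinv a \<circ> pinv b = id"
  shows "a \<circ> b = b \<circ> a"
proof
  fix w
  have "(a \<circ> b \<circ> pinv a \<circ> pinv b) (b (a w)) = b (a w)" using assms(3) by simp
  then show "(a \<circ> b) w = (b \<circ> a) w" using assms(1,2) by (simp add: pinv_left)
qed

lemma tree_aut_bij:
  assumes "g \<in> tree_aut m" shows "bij g"
proof -
  have "bij_betw g (verts m) (verts m)" "\<forall>x\<in>- verts m. g x = x"
    using assms by (auto simp: tree_aut_def)
  moreover from this(2) have "bij_betw g (- verts m) (- verts m)"
    using bij_betw_cong[of "- verts m" g id] by (metis bij_betw_id id_apply)
  ultimately have "bij_betw g (verts m \<union> - verts m) (verts m \<union> - verts m)"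
    by (intro bij_betw_combine) auto
  then show ?thesis by simp
qed

lemma tree_aut_verts: "g \<in> tree_aut m \<Longrightarrow> g w \<in> verts m \<longleftrightarrow> w \<in> verts m"
  using bij_betw_imp_surj_on[of g "verts m" "verts m"] by (auto simp: tree_aut_def)

lemma tree_aut_id: "id \<in> tree_aut m"
  by (simp add: tree_aut_def)

lemma tree_aut_comp: "g \<in> tree_aut m \<Longrightarrow> h \<in> tree_aut m \<Longrightarrow> g \<circ> h \<in> tree_aut m"
proof -
  assume g: "g \<in> tree_aut m" and h: "h \<in> tree_aut m"
  have "adjacent u w \<longleftrightarrow> adjacent (g (h u)) (g (h w))" if "u \<in> verts m" "w \<in> verts m" for u w
  proof -
    have "adjacent u w \<longleftrightarrow> adjacent (h u) (h w)" using h that by (auto simp: tree_aut_def)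
    also have "\<dots> \<longleftrightarrow> adjacent (g (h u)) (g (h w))"
      using g that tree_aut_verts[OF h] unfolding tree_aut_def by blast
    finally show ?thesis .
  qed
  moreover have "bij_betw (g \<circ> h) (verts m) (verts m)"
    using g h bij_betw_trans unfolding tree_aut_def by blast
  moreover have "(g \<circ> h) [] = []" "\<forall>x. x \<notin> verts m \<longrightarrow> (g \<circ> h) x = x"
    using g h unfolding tree_aut_def by auto
  ultimately show ?thesis by (simp add: tree_aut_def)
qed

lemma tree_aut_pinv:
  assumes g: "g \<in> tree_aut m" shows "pinv g \<in> tree_aut m"
proof -
  have b: "bij g" by (rule tree_aut_bij[OF g])
  have v: "pinv g w \<in> verts m \<longleftrightarrow> w \<in> verts m" for w
    using tree_aut_verts[OF g, of "pinv g w"] pinv_right[OF b] by simp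
  have "bij_betw (pinv g) (verts m) (verts m)"
    by (rule bij_betw_byWitness[where f' = g]) (auto simp: pinv_left pinv_right b v tree_aut_verts[OF g])
  moreover have "pinv g [] = []" using g pinv_left[OF b, of "[]"] by (simp add: tree_aut_def)
  moreover have "adjacent u w \<longleftrightarrow> adjacent (pinv g u) (pinv g w)" if "u \<in> verts m" "w \<in> verts m" for u w
  proof -
    have "adjacent (pinv g u) (pinv g w) \<longleftrightarrow> adjacent (g (pinv g u)) (g (pinv g w))"
      using g that v by (simp add: tree_aut_def)
    then show ?thesis by (simp add: pinv_right[OF b])
  qed
  moreover have "pinv g x = x" if "x \<notin> verts m" for x
    using g that pinv_left[OF b, of x] by (simp add: tree_aut_def)
  ultimately show ?thesis by (simp add: tree_aut_def)
qed

lemma AutT_simps [simp]: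
  "carrier (AutT m) = tree_aut m" "x \<otimes>\<^bsub>AutT m\<^esub> y = x \<circ> y" "\<one>\<^bsub>AutT m\<^esub> = id"
  by (simp_all add: AutT_def)

lemma group_AutT: "group (AutT m)"
proof (rule groupI)
  fix x assume "x \<in> carrier (AutT m)"
  then have "pinv x \<in> tree_aut m" "pinv x \<circ> x = id"
    using tree_aut_bij[of x m] by (auto simp: tree_aut_pinv bij_is_inj)
  then show "\<exists>y\<in>carrier (AutT m). y \<otimes>\<^bsub>AutT m\<^esub> x = \<one>\<^bsub>AutT m\<^esub>" by auto
qed (auto simp: tree_aut_comp tree_aut_id comp_assoc)

lemma AutT_inv: "x \<in> tree_aut m \<Longrightarrow> inv\<^bsub>AutT m\<^esub> x = pinv x"
  using group.inv_equality[OF group_AutT, where x = x and y = "pinv x"]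
  by (simp add: tree_aut_pinv bij_is_inj tree_aut_bij)

lemma subgroup_AutT_iff:
  "subgroup H (AutT m) \<longleftrightarrow> H \<subseteq> tree_aut m \<and> id \<in> H \<and>
     (\<forall>x\<in>H. \<forall>y\<in>H. x \<circ> y \<in> H) \<and> (\<forall>x\<in>H. pinv x \<in> H)"
  using AutT_inv by (auto simp: subgroup_def subset_iff)

lemma subgroup_AutT_sub_iff:
  assumes "subgroup G (AutT m)"
  shows "subgroup H ((AutT m)\<lparr>carrier := G\<rparr>) \<longleftrightarrow> subgroup H (AutT m) \<and> H \<subseteq> G"
proof
  assume H: "subgroup H ((AutT m)\<lparr>carrier := G\<rparr>)"
  then show "subgroup H (AutT m) \<and> H \<subseteq> G"
    using group.incl_subgroup[OF group_AutT assms H] subgroup.subset[OF H] by simp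
next
  assume "subgroup H (AutT m) \<and> H \<subseteq> G"
  then show "subgroup H ((AutT m)\<lparr>carrier := G\<rparr>)"
    using group.subgroup_incl[OF group_AutT _ assms] by blast
qed

lemma generate_AutT_least:
  "S \<subseteq> H \<Longrightarrow> subgroup H (AutT m) \<Longrightarrow> generate (AutT m) S \<subseteq> H"
  using group.generate_subgroup_incl[OF group_AutT] by blast

lemma generate_AutT_subgroup: "S \<subseteq> tree_aut m \<Longrightarrow> subgroup (generate (AutT m) S) (AutT m)"
  using group.generate_is_subgroup[OF group_AutT] by simp

text \<open>Adjacency is undirected, so the direction is recovered by induction from the root: the
  image of a child is a neighbour of the image of its parent, and it is not the upper neighbour,
  since that one is already the image of the grandparent.\<close>

lemma tree_aut_child:
  assumes g: "g \<in> tree_aut m" and w: "u @ [a] \<in> verts m"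
  shows "\<exists>b. g (u @ [a]) = g u @ [b]"
  using w
proof (induction u arbitrary: a rule: rev_induct)
  case Nil
  have "[] \<in> verts m" by (simp add: verts_def)
  then have "adjacent (g []) (g [a])"
    using g Nil unfolding tree_aut_def adjacent_def by fastforce
  then show ?case using g by (auto simp: adjacent_def tree_aut_def)
next
  case (snoc c u)
  have u: "u @ [c] \<in> verts m"
    unfolding verts_def
  proof safe
    fix i assume "i < length (u @ [c])"
    then show "(u @ [c]) ! i < m i" using snoc.prems[unfolded verts_def]
      by (auto simp: nth_append split: if_splits dest!: spec[of _ i])
  qed
  have "adjacent (u @ [c]) ((u @ [c]) @ [a])" by (auto simp: adjacent_def)
  then have "adjacent (g (u @ [c])) (g ((u @ [c]) @ [a]))"
    using g u snoc.prems by (auto simp: tree_aut_def)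
  moreover have False if "g (u @ [c]) = g ((u @ [c]) @ [a]) @ [b]" for b
  proof -
    have "g u = g ((u @ [c]) @ [a])" using snoc.IH[OF u] that by auto
    then have "u = (u @ [c]) @ [a]" using tree_aut_bij[OF g] by (simp add: bij_is_inj inj_eq)
    then show False by simp
  qed
  ultimately show ?case unfolding adjacent_def by blast
qed

lemma verts_append: "u @ w \<in> verts m \<Longrightarrow> u \<in> verts m"
  unfolding verts_def
proof safe
  fix i assume "\<forall>i<length (u @ w). (u @ w) ! i < m i" "i < length u"
  then show "u ! i < m i" by (auto simp: nth_append dest!: spec[of _ i])
qed

lemma tree_aut_append:
  assumes g: "g \<in> tree_aut m" and "u @ w \<in> verts m"
  shows "\<exists>w'. g (u @ w) = g u @ w' \<and> length w' = length w"
  using assms(2)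
proof (induction w rule: rev_induct)
  case (snoc a w)
  then have "(u @ w) @ [a] \<in> verts m" by simp
  from tree_aut_child[OF g this] snoc.IH verts_append[OF this] show ?case by force
qed simp

lemma tree_aut_length: "g \<in> tree_aut m \<Longrightarrow> w \<in> verts m \<Longrightarrow> length (g w) = length w"
  using tree_aut_append[of g m "[]" w] by (auto simp: tree_aut_def)

lemma tree_aut_subtree:
  assumes g: "g \<in> tree_aut m" and "w \<in> subtree m v"
  shows "g w \<in> subtree m (g v)"
  using assms tree_aut_append[OF g] by (auto simp: subtree_def tree_aut_verts)

section \<open>Subtrees and rigid vertex stabilizers\<close>

lemma subtree_disjoint:
  "length u = length v \<Longrightarrow> u \<noteq> v \<Longrightarrow> w \<in> subtree m u \<Longrightarrow> w \<notin> subtree m v"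
  by (auto simp: subtree_def)

lemma subtree_mono: "u \<in> subtree m v \<Longrightarrow> subtree m u \<subseteq> subtree m v"
  by (auto simp: subtree_def)

lemma subtree_self: "v \<in> verts m \<Longrightarrow> v \<in> subtree m v"
  by (auto simp: subtree_def)

text \<open>Automorphisms fix all non-vertices, so the support can be tested on arbitrary words,
  which spares later arguments the condition \<open>w \<in> verts m\<close>.\<close>

lemma rist_iff:
  assumes "G \<subseteq> tree_aut m"
  shows "x \<in> rist m G v \<longleftrightarrow> x \<in> G \<and> (\<forall>w. w \<notin> subtree m v \<longrightarrow> x w = w)"
proof -
  have "x w = w" if "x \<in> G" "w \<notin> verts m" for w
    using that assms by (auto simp: tree_aut_def)
  moreover have "subtree m v \<subseteq> verts m" by (auto simp: subtree_def)
  ultimately show ?thesis by (auto simp: rist_def)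
qed

lemma bij_supported:
  assumes "bij x" "\<forall>w. w \<notin> U \<longrightarrow> x w = w" "w \<in> U"
  shows "x w \<in> U"
proof (rule ccontr)
  assume "x w \<notin> U"
  then have "x (x w) = x w" using assms(2) by blast
  then have "x w = w" using assms(1) by (simp add: bij_is_inj inj_eq)
  then show False using \<open>x w \<notin> U\<close> assms(3) by simp
qed

lemma disjoint_support_commute:
  assumes "bij x" "bij y" "\<forall>w. w \<notin> U \<longrightarrow> x w = w" "\<forall>w. w \<notin> W \<longrightarrow> y w = w" "U \<inter> W = {}"
  shows "x \<circ> y = y \<circ> x"
proof
  fix w show "(x \<circ> y) w = (y \<circ> x) w"
    using assms bij_supported[of x U w] bij_supported[of y W w]
    by (cases "w \<in> U"; cases "w \<in> W") (auto simp: disjoint_iff)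
qed

lemma subgroup_AutT:
  assumes "subgroup H (AutT m)"
  shows "id \<in> H" "x \<in> H \<Longrightarrow> y \<in> H \<Longrightarrow> x \<circ> y \<in> H" "x \<in> H \<Longrightarrow> pinv x \<in> H"
    "x \<in> H \<Longrightarrow> x \<in> tree_aut m" "x \<in> H \<Longrightarrow> bij x" "x \<in> H \<Longrightarrow> x ^^ n \<in> H"
proof -
  show "id \<in> H" "x \<in> H \<Longrightarrow> y \<in> H \<Longrightarrow> x \<circ> y \<in> H" "x \<in> H \<Longrightarrow> pinv x \<in> H"
    "x \<in> H \<Longrightarrow> x \<in> tree_aut m" "x \<in> H \<Longrightarrow> bij x"
    using assms tree_aut_bij by (auto simp: subgroup_AutT_iff)
  then show "x \<in> H \<Longrightarrow> x ^^ n \<in> H"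
    using assms by (induction n) (auto simp: subgroup_AutT_iff simp del: o_apply)
qed

lemma finite_indexD:
  assumes G: "subgroup G (AutT m)" and K: "finite_index m K G"
  shows "subgroup K (AutT m)" "K \<subseteq> G" "\<exists>T. finite T \<and> T \<subseteq> G \<and> G \<subseteq> K <#>\<^bsub>AutT m\<^esub> T"
proof -
  have "subgroup K ((AutT m)\<lparr>carrier := G\<rparr>)" using K by (simp add: finite_index_def)
  then show "subgroup K (AutT m)" "K \<subseteq> G" by (simp_all add: subgroup_AutT_sub_iff[OF G])
  show "\<exists>T. finite T \<and> T \<subseteq> G \<and> G \<subseteq> K <#>\<^bsub>AutT m\<^esub> T"
    using group.finite_rcosets_transversal[OF group_AutT G] K by (auto simp: finite_index_def)
qed

text \<open>Among infinitely many indices two have values in the same one of the finitely many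
  cosets of \<open>K\<close>. This serves both to find nontrivial elements of \<open>K\<close> and
  to find powers of a given element in \<open>K\<close>.\<close>

lemma finite_index_pigeonhole:
  assumes G: "subgroup G (AutT m)" and K: "finite_index m K G"
    and f: "\<And>i::nat. f i \<in> G"
  shows "\<exists>i j. i < j \<and> f j \<circ> pinv (f i) \<in> K"
proof -
  obtain T where T: "finite T" "T \<subseteq> G" "G \<subseteq> K <#>\<^bsub>AutT m\<^esub> T"
    using finite_indexD[OF G K] by blast
  have sK: "subgroup K (AutT m)" using finite_indexD[OF G K] by blast
  have "\<exists>t. t \<in> T \<and> (\<exists>k\<in>K. f i = k \<circ> t)" for i
  proof -
    have "f i \<in> K <#>\<^bsub>AutT m\<^esub> T" using f[of i] T(3) by blast
    then show ?thesis by (auto simp: set_mult_def)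
  qed
  then obtain t where t: "\<And>i. t i \<in> T" "\<And>i. \<exists>k\<in>K. f i = k \<circ> t i" by metis
  have "\<not> inj t" using t(1) T(1) by (meson finite_imageD finite_subset image_subsetI infinite_UNIV_nat)
  then obtain i j where ij: "i < j" "t i = t j" by (metis injI linorder_neqE_nat)
  obtain k l where kl: "k \<in> K" "l \<in> K" "f i = k \<circ> t i" "f j = l \<circ> t i"
    using t(2)[of i] t(2)[of j] ij(2) by auto
  have b: "bij k" "bij l" "bij (f i)"
    using kl(1,2) subgroup_AutT(5)[OF sK] subgroup_AutT(5)[OF G] f by blast+
  have "f j \<circ> pinv (f i) = l \<circ> pinv k"
  proof
    fix w
    have "t i (pinv (f i) w) = pinv k w"
      using pinv_right[OF b(3), of w] kl(3) pinv_left[OF b(1)] by (metis comp_apply)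
    then show "(f j \<circ> pinv (f i)) w = (l \<circ> pinv k) w" by (simp add: kl(4))
  qed
  moreover have "l \<circ> pinv k \<in> K" using kl(1,2) subgroup_AutT(2,3)[OF sK] by blast
  ultimately show ?thesis using ij(1) by metis
qed

lemma rist_subgroup:
  assumes G: "subgroup G (AutT m)"
  shows "subgroup (rist m G v) (AutT m)"
proof -
  have Gs: "G \<subseteq> tree_aut m" using G by (simp add: subgroup_AutT_iff)
  have "pinv x w = w" if "x \<in> G" "x w = w" for x w
    using that pinv_left[of x w] subgroup_AutT[OF G] by simp
  then show ?thesis
    using Gs subgroup_AutT[OF G] by (auto simp: subgroup_AutT_iff rist_iff[OF Gs])
qed

lemma rist_conj:
  assumes G: "subgroup G (AutT m)" and g: "g \<in> G" and x: "x \<in> rist m G v"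
  shows "g \<circ> x \<circ> pinv g \<in> rist m G (g v)"
proof -
  have Gs: "G \<subseteq> tree_aut m" using G by (simp add: subgroup_AutT_iff)
  have b: "bij g" and gT: "g \<in> tree_aut m" using subgroup_AutT[OF G] g by auto
  have "x (pinv g w) = pinv g w" if "w \<notin> subtree m (g v)" for w
  proof -
    have "pinv g w \<notin> subtree m v"
      using tree_aut_subtree[OF gT, of "pinv g w" v] that pinv_right[OF b] by auto
    then show ?thesis using x by (simp add: rist_iff[OF Gs])
  qed
  then show ?thesis
    using x g subgroup_AutT[OF G] by (auto simp: rist_iff[OF Gs] pinv_right[OF b])
qed

lemma rist_mono: "u \<in> subtree m v \<Longrightarrow> rist m G u \<subseteq> rist m G v"
  using subtree_mono[of u m v] by (auto simp: rist_def)

lemma rist_commute: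
  assumes G: "subgroup G (AutT m)" and "x \<in> rist m G u" "y \<in> rist m G v"
    "length u = length v" "u \<noteq> v"
  shows "x \<circ> y = y \<circ> x"
proof -
  have Gs: "G \<subseteq> tree_aut m" using G by (simp add: subgroup_AutT_iff)
  show ?thesis
    by (rule disjoint_support_commute[where U = "subtree m u" and W = "subtree m v"])
      (use assms subtree_disjoint[of u v] subgroup_AutT(5)[OF rist_subgroup[OF G]]
        in \<open>auto simp: rist_iff[OF Gs]\<close>)
qed

text \<open>An element supported below \<open>v\<close> preserves the subtree at \<open>v\<close>,
  in which \<open>v\<close> is the only vertex of its level.\<close>

lemma rist_fixes_level:
  assumes G: "subgroup G (AutT m)" and x: "x \<in> rist m G v" and u: "u \<in> verts m" "length u = length v"
  shows "x u = u"
proof (cases "u = v")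
  case True
  have Gs: "G \<subseteq> tree_aut m" using G by (simp add: subgroup_AutT_iff)
  have xT: "x \<in> tree_aut m" using subgroup_AutT[OF rist_subgroup[OF G]] x by auto
  have "x v \<in> subtree m v"
    by (rule bij_supported[OF tree_aut_bij[OF xT]])
      (use x u True subtree_self in \<open>auto simp: rist_iff[OF Gs]\<close>)
  then show ?thesis using True tree_aut_length[OF xT u(1)] by (auto simp: subtree_def)
next
  case False
  then have "u \<notin> subtree m v" using u by (auto simp: subtree_def)
  then show ?thesis using x u by (simp add: rist_def)
qed

section \<open>Branch groups\<close>

locale branch_group =
  fixes m :: "nat \<Rightarrow> nat" and G :: "(nat list \<Rightarrow> nat list) set"
  assumes m2: "m n \<ge> 2"
    and G: "subgroup G (AutT m)"
    and fg: "fin_gen m G"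
    and br: "branch m G"
begin

lemma G_sub: "G \<subseteq> tree_aut m"
  using G by (simp add: subgroup_AutT_iff)

lemmas G_closed = subgroup_AutT[OF G]
lemmas rist_G_iff = rist_iff[OF G_sub]
lemmas rist_closed = subgroup_AutT[OF rist_subgroup[OF G]]

section \<open>Infinitude of \<open>G\<close> and nontriviality of rigid stabilizers\<close>

lemma transitive:
  assumes "u \<in> verts m" "w \<in> verts m" "length u = length w"
  shows "\<exists>g\<in>G. g u = w"
  using br assms by (auto simp: branch_def level_transitive_def level_def)

text \<open>For \<open>a = 1\<close> and varying \<open>i\<close> these vertices are the teeth of a
  comb along the ray \<open>u 000...\<close>: pairwise incomparable, hence roots of disjoint
  subtrees below \<open>u\<close>.\<close>

lemma comb_verts: "u \<in> verts m \<Longrightarrow> a \<le> 1 \<Longrightarrow> u @ replicate i 0 @ [a] \<in> verts m"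
  using m2 less_le_trans[OF _ m2] unfolding verts_def
  by (fastforce simp: nth_append nth_Cons' less_Suc_eq)

text \<open>Let \<open>f i\<close> carry the vertex \<open>0^i 0\<close> to its sibling
  \<open>0^i 1\<close>. For \<open>i < j\<close>, \<open>f j\<close> carries \<open>0^j 0\<close> to
  \<open>0^j 1\<close>, hence fixes the common prefix \<open>0^i 0\<close>, which \<open>f i\<close>
  moves.\<close>

lemma infinite_sequence: "\<exists>f::nat \<Rightarrow> _. (\<forall>i. f i \<in> G) \<and> inj f"
proof -
  have V: "replicate i 0 @ [a] \<in> verts m" if "a \<le> 1" for i a
    using comb_verts[of "[]" a i] that by (simp add: verts_def)
  have "\<exists>g\<in>G. g (replicate i 0 @ [0]) = replicate i 0 @ [1]" for i
    using V by (intro transitive) auto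
  then obtain f where f: "\<And>i. f i \<in> G" "\<And>i. f i (replicate i 0 @ [0]) = replicate i 0 @ [1]"
    by metis
  have "f i \<noteq> f j" if ij: "i < j" for i j
  proof -
    obtain k where k: "j = Suc i + k" using less_imp_Suc_add[OF ij] by auto
    have rj: "replicate j 0 = (replicate i 0 @ [0::nat]) @ replicate k 0"
      unfolding replicate_append_same by (simp add: k replicate_add)
    have e: "replicate j 0 @ [0] = (replicate i 0 @ [0]) @ (replicate k 0 @ [0::nat])"
      using rj by simp
    obtain w where "f j ((replicate i 0 @ [0]) @ (replicate k 0 @ [0])) = f j (replicate i 0 @ [0]) @ w"
      using tree_aut_append[of "f j" m "replicate i 0 @ [0]" "replicate k 0 @ [0]"] V[of 0 j] e f G_sub
      by auto
    moreover have "f j (replicate j 0 @ [0]) = (replicate i 0 @ [0]) @ replicate k 0 @ [1]"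
      using f(2)[of j] rj by simp
    ultimately have E: "f j (replicate i 0 @ [0]) @ w = (replicate i 0 @ [0]) @ replicate k 0 @ [1]"
      using e by simp
    have "length (f j (replicate i 0 @ [0])) = length (replicate i 0 @ [0::nat])"
      by (rule tree_aut_length[of _ m]) (use V[of 0 i] f(1)[of j] G_sub in auto)
    then have "f j (replicate i 0 @ [0]) = replicate i 0 @ [0]"
      using E append_eq_append_conv[of _ "replicate i 0 @ [0]"] by blast
    then show ?thesis using f(2)[of i] by auto
  qed
  then have "inj f" by (metis injI linorder_neqE_nat)
  then show ?thesis using f by blast
qed

lemma Rist_finite_index: "n \<ge> 1 \<Longrightarrow> finite_index m (Rist m G n) G"
  using br by (simp add: branch_def)

text \<open>By level transitivity the rigid stabilizers of one level are conjugate. If one were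
  trivial, so would be \<open>Rist m G (length u)\<close>, and its finite index would contradict the
  infinitude of \<open>G\<close>.\<close>

lemma rist_nontrivial:
  assumes u: "u \<in> verts m" "u \<noteq> []"
  shows "\<exists>x\<in>rist m G u. x \<noteq> id"
proof (rule ccontr)
  assume "\<not> ?thesis"
  then have triv: "rist m G u \<subseteq> {id}" by auto
  have "rist m G w \<subseteq> {id}" if w: "w \<in> level m (length u)" for w
  proof
    fix x assume x: "x \<in> rist m G w"
    obtain g where g: "g \<in> G" "g w = u"
      using transitive[of w u] u w by (auto simp: level_def)
    have b: "bij g" using G_closed g by blast
    have "g \<circ> x \<circ> pinv g = id" using rist_conj[OF G g(1) x] g(2) triv by auto
    then have "g (x (pinv g (g z))) = g z" for z by (metis comp_apply id_apply)
    then have "x z = z" for z using b by (simp add: pinv_left bij_is_inj inj_eq)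
    then show "x \<in> {id}" by auto
  qed
  moreover have "subgroup {id} (AutT m)"
    using group.triv_subgroup[OF group_AutT] by simp
  ultimately have R: "Rist m G (length u) \<subseteq> {id}"
    unfolding Rist_def by (intro generate_AutT_least) auto
  obtain f :: "nat \<Rightarrow> _" where f: "\<And>i. f i \<in> G" "inj f" using infinite_sequence by auto
  have fi: "finite_index m (Rist m G (length u)) G"
    using Rist_finite_index u by (simp add: Suc_leI)
  obtain i j where "i < j" "f j \<circ> pinv (f i) \<in> Rist m G (length u)"
    using finite_index_pigeonhole[OF G fi f(1)] by blast
  then show False
    using R pinv_comp_neq_id[of "f i" "f j"] f G_closed injD[OF f(2), of i j] by auto
qed

text \<open>Nontrivial elements rigid at the teeth of the comb below \<open>u\<close> are pairwise
  distinct because their supports are disjoint; the pigeonhole quotient of two of them is a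
  nontrivial element of \<open>K\<close>.\<close>

lemma finite_index_rist_nontrivial:
  assumes K: "finite_index m K G" and u: "u \<in> verts m"
  shows "\<exists>x\<in>K \<inter> rist m G u. x \<noteq> id"
proof -
  let ?v = "\<lambda>i. u @ replicate i 0 @ [1]"
  have V: "?v i \<in> verts m" for i using comb_verts[OF u] by simp
  have "\<exists>x\<in>rist m G (?v i). x \<noteq> id" for i using rist_nontrivial V by simp
  then obtain f where f: "\<And>i. f i \<in> rist m G (?v i)" "\<And>i. f i \<noteq> id" by metis
  have fu: "f i \<in> rist m G u" for i
    using f(1)[of i] rist_mono[of "?v i" m u G] V[of i] by (auto simp: subtree_def)
  have ne: "f i \<noteq> f j" if "i < j" for i j
  proof
    assume e: "f i = f j"
    obtain w where w: "f i w \<noteq> w" using f(2)[of i] by (auto simp: fun_eq_iff)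
    have "w \<in> subtree m (?v i)" "w \<in> subtree m (?v j)"
      using w e f(1)[of i] f(1)[of j] by (auto simp: rist_G_iff)
    then obtain y z where yz: "?v i @ y = ?v j @ z" unfolding subtree_def by blast
    \<comment> \<open>This position holds the digit 1 in the tooth \<open>?v i\<close> but 0 in
      \<open>?v j\<close>, as \<open>i < j\<close>.\<close>
    have "(?v i @ y) ! (length u + i) = 1" by (simp add: nth_append)
    moreover have "(?v j @ z) ! (length u + i) = 0" using that by (simp add: nth_append)
    ultimately show False using yz by simp
  qed
  have fG: "f i \<in> G" for i using f(1)[of i] by (simp add: rist_def)
  obtain i j where ij: "i < j" "f j \<circ> pinv (f i) \<in> K"
    using finite_index_pigeonhole[OF G K fG] by blast
  have "f j \<circ> pinv (f i) \<in> rist m G u"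
    by (intro rist_closed(2,3) fu)
  moreover have "f j \<circ> pinv (f i) \<noteq> id"
    by (rule pinv_comp_neq_id[OF G_closed(5)[OF fG] ne[OF ij(1)]])
  ultimately show ?thesis using ij(2) by blast
qed

text \<open>Let \<open>a\<close> move \<open>w\<close>, and let \<open>b\<close> in \<open>K\<close>
  be rigid at \<open>w\<close> and move \<open>z\<close>. Then \<open>a z\<close> lies below
  \<open>a w\<close>, where \<open>b\<close> is trivial, so \<open>b (a z) = a z\<close> while
  \<open>a (b z) \<noteq> a z\<close>.\<close>

lemma rist_not_central:
  assumes K: "finite_index m K G" and a: "a \<in> rist m G u" "a \<noteq> id"
  shows "\<exists>b\<in>K \<inter> rist m G u. a \<circ> b \<noteq> b \<circ> a"
proof -
  obtain w where w: "a w \<noteq> w" using a(2) by (auto simp: fun_eq_iff)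
  have wu: "w \<in> subtree m u" using w a(1) by (auto simp: rist_G_iff)
  then have wv: "w \<in> verts m" by (simp add: subtree_def)
  have aT: "a \<in> tree_aut m" using a(1) rist_closed by blast
  obtain b where b: "b \<in> K" "b \<in> rist m G w" "b \<noteq> id"
    using finite_index_rist_nontrivial[OF K wv] by auto
  obtain z where z: "b z \<noteq> z" using b(3) by (auto simp: fun_eq_iff)
  have zw: "z \<in> subtree m w" using z b(2) by (auto simp: rist_G_iff)
  have "a z \<notin> subtree m w"
    using subtree_disjoint[OF _ w tree_aut_subtree[OF aT zw]] tree_aut_length[OF aT wv] by simp
  then have "b (a z) = a z" using b(2) by (simp add: rist_G_iff)
  moreover have "a (b z) \<noteq> a z" using z tree_aut_bij[OF aT] by (simp add: bij_is_inj inj_eq)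
  ultimately have "a \<circ> b \<noteq> b \<circ> a" by (metis comp_apply)
  then show ?thesis using b rist_mono[OF wu] by blast
qed

section \<open>Finite generation of rigid stabilizers\<close>

lemma fin_gen_finite_index:
  assumes H: "fin_gen m H" "H \<subseteq> G" and K: "subgroup K (AutT m)" "K \<subseteq> H"
    and T: "finite T" "T \<subseteq> H" "H \<subseteq> K <#>\<^bsub>AutT m\<^esub> T"
  shows "fin_gen m K"
proof -
  obtain S where S: "finite S" "S \<subseteq> H" "generate (AutT m) S = H"
    using H by (auto simp: fin_gen_def)
  show ?thesis
    using group.finite_index_fin_gen[OF group_AutT K S(1) _ S(3) T] S(2) H(2) G_sub
    by (auto simp: fin_gen_def)
qed

text \<open>Restriction to the subtree at \<open>v\<close>, extended by the identity. It is
  multiplicative on the automorphisms fixing \<open>v\<close>.\<close>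

definition proj :: "nat list \<Rightarrow> (nat list \<Rightarrow> nat list) \<Rightarrow> nat list \<Rightarrow> nat list" where
  "proj v x = (\<lambda>w. if w \<in> subtree m v then x w else w)"

lemma proj_comp:
  assumes "y \<in> tree_aut m" "y v = v"
  shows "proj v (x \<circ> y) = proj v x \<circ> proj v y"
  using tree_aut_subtree[OF assms(1), of _ v] assms(2) by (auto simp: proj_def fun_eq_iff)

lemma proj_pinv:
  assumes x: "x \<in> tree_aut m" "x v = v"
  shows "proj v (pinv x) = pinv (proj v x)"
proof -
  have b: "bij x" by (rule tree_aut_bij[OF x(1)])
  have pv: "pinv x v = v" using pinv_left[OF b, of v] x(2) by simp
  have "proj v x \<circ> proj v (pinv x) = proj v (x \<circ> pinv x)"
    using proj_comp[OF tree_aut_pinv[OF x(1)] pv] by simp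
  moreover have "proj v (pinv x) \<circ> proj v x = proj v (pinv x \<circ> x)"
    using proj_comp[OF x] by simp
  moreover have "proj v (x \<circ> pinv x) = id" "proj v (pinv x \<circ> x) = id"
    by (auto simp: proj_def pinv_left[OF b] pinv_right[OF b])
  ultimately show ?thesis by (metis inv_unique_comp)
qed

text \<open>It suffices to look at generators: \<open>proj v\<close> leaves elements rigid at
  \<open>v\<close> unchanged and kills those rigid at another vertex of the level. It is thus the
  projection of the direct product onto its factor at \<open>v\<close>.\<close>

lemma proj_Rist:
  assumes v: "v \<in> verts m" and x: "x \<in> Rist m G (length v)"
  shows "x v = v \<and> proj v x \<in> rist m G v"
proof -
  define Q where "Q = {x \<in> G. x v = v \<and> proj v x \<in> rist m G v}"
  have "(\<Union>u\<in>level m (length v). rist m G u) \<subseteq> Q"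
  proof
    fix x assume "x \<in> (\<Union>u\<in>level m (length v). rist m G u)"
    then obtain u where u: "u \<in> verts m" "length u = length v" "x \<in> rist m G u"
      by (auto simp: level_def)
    have "x v = v" using rist_fixes_level[OF G u(3) v] u by simp
    moreover have "proj v x \<in> rist m G v"
    proof (cases "u = v")
      case True
      then have "proj v x = x" using u by (auto simp: proj_def rist_G_iff fun_eq_iff)
      then show ?thesis using u True by simp
    next
      case False
      then have "proj v x = id"
        using u subtree_disjoint[of v u] by (auto simp: proj_def rist_G_iff fun_eq_iff)
      then show ?thesis using rist_closed(1) by simp
    qed
    ultimately show "x \<in> Q" using u by (simp add: Q_def rist_def)
  qed
  moreover have "subgroup Q (AutT m)"
    unfolding subgroup_AutT_iff
  proof (intro conjI ballI)
    show "Q \<subseteq> tree_aut m" using G_sub by (auto simp: Q_def)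
    have "proj v id = id" by (auto simp: proj_def)
    then show id: "id \<in> Q" using G_closed rist_closed by (auto simp: Q_def)
    fix x assume x: "x \<in> Q"
    have b: "bij x" using x G_closed by (simp add: Q_def)
    show "x \<circ> y \<in> Q" if "y \<in> Q" for y
      using x that proj_comp[of y v x] G_closed rist_closed by (auto simp: Q_def)
    have pv: "pinv x v = v" using pinv_left[OF b, of v] x by (simp add: Q_def)
    have pG: "pinv x \<in> G" using x G_closed by (simp add: Q_def)
    have "proj v (pinv x) = pinv (proj v x)"
      using x G_closed by (intro proj_pinv) (auto simp: Q_def)
    then show "pinv x \<in> Q" using x rist_closed pv pG by (auto simp: Q_def)
  qed
  ultimately show ?thesis
    using x generate_AutT_least unfolding Rist_def Q_def by blast
qed

text \<open>\<open>Rist m G (length v)\<close> has finite index in \<open>G\<close>, so it is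
  finitely generated by Schreier's lemma, and \<open>rist m G v\<close> is its image under
  \<open>proj v\<close>.\<close>

lemma fin_gen_rist:
  assumes v: "v \<in> verts m" "v \<noteq> []"
  shows "fin_gen m (rist m G v)"
proof -
  let ?R = "Rist m G (length v)"
  have fi: "finite_index m ?R G" using Rist_finite_index v by (simp add: Suc_leI)
  obtain T where "finite T" "T \<subseteq> G" "G \<subseteq> ?R <#>\<^bsub>AutT m\<^esub> T"
    using finite_indexD[OF G fi] by blast
  then have "fin_gen m ?R"
    using fin_gen_finite_index[OF fg] finite_indexD[OF G fi] by blast
  then obtain S where S: "finite S" "S \<subseteq> ?R" "generate (AutT m) S = ?R"
    by (auto simp: fin_gen_def)
  let ?P = "generate (AutT m) (proj v ` S)"
  have PS: "proj v ` S \<subseteq> rist m G v" using S(2) proj_Rist[OF v(1)] by blast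
  have P: "subgroup ?P (AutT m)"
    using PS rist_closed(4) by (intro generate_AutT_subgroup) blast
  have RG: "?R \<subseteq> G" using finite_indexD[OF G fi] by blast
  have sR: "subgroup ?R (AutT m)" using finite_indexD[OF G fi] by blast
  \<comment> \<open>The part of \<open>?R\<close> sent into \<open>?P\<close> by
    \<open>proj v\<close> is a subgroup containing the generators \<open>S\<close>, hence all of
    \<open>?R\<close>; elements of \<open>rist m G v\<close> are their own projections.\<close>
  define Q where "Q = {x \<in> ?R. proj v x \<in> ?P}"
  have "subgroup Q (AutT m)"
    unfolding subgroup_AutT_iff
  proof (intro conjI ballI)
    show "Q \<subseteq> tree_aut m" using G_sub RG by (auto simp: Q_def)
    have pid: "proj v id = id" by (auto simp: proj_def)
    then show "id \<in> Q" using subgroup_AutT(1)[OF P] subgroup_AutT(1)[OF sR] by (auto simp: Q_def)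
    fix x assume x: "x \<in> Q"
    show "x \<circ> y \<in> Q" if "y \<in> Q" for y
      using x that proj_comp[of y v x] RG G_closed(4) subgroup_AutT(2)[OF P] subgroup_AutT(2)[OF sR]
        proj_Rist[OF v(1)] by (auto simp: Q_def)
    have pR: "pinv x \<in> ?R" using x subgroup_AutT(3)[OF sR] by (simp add: Q_def)
    have "proj v (pinv x) = pinv (proj v x)"
      using x RG G_closed(4) proj_Rist[OF v(1)] by (intro proj_pinv) (auto simp: Q_def)
    then show "pinv x \<in> Q" using x pR subgroup_AutT(3)[OF P] by (auto simp: Q_def)
  qed
  moreover have "S \<subseteq> Q" using S(2) by (auto simp: Q_def intro: generate.incl)
  ultimately have RQ: "?R \<subseteq> Q" using generate_AutT_least S(3) by metis
  have "rist m G v \<subseteq> ?P"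
  proof
    fix x assume x: "x \<in> rist m G v"
    then have "x \<in> ?R" unfolding Rist_def
      using v by (intro generate.incl) (auto simp: level_def)
    moreover have "proj v x = x" using x by (auto simp: proj_def rist_G_iff fun_eq_iff)
    ultimately show "x \<in> ?P" using RQ by (auto simp: Q_def)
  qed
  moreover have "?P \<subseteq> rist m G v" using generate_AutT_least[OF PS rist_subgroup[OF G]] .
  ultimately show ?thesis using S(1) PS by (auto simp: fin_gen_def intro!: exI[of _ "proj v ` S"])
qed

text \<open>Finite index passes to the intersection with \<open>rist m G v\<close>, where Schreier's
  lemma applies again.\<close>

lemma fin_gen_Int_rist:
  assumes v: "v \<in> verts m" "v \<noteq> []" and K: "finite_index m K G"
  shows "fin_gen m (K \<inter> rist m G v)"
proof -
  obtain T where T: "finite T" "T \<subseteq> G" "G \<subseteq> K <#>\<^bsub>AutT m\<^esub> T"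
    using finite_indexD[OF G K] by blast
  have sK: "subgroup K (AutT m)" using finite_indexD[OF G K] by blast
  have RG: "rist m G v \<subseteq> G" by (auto simp: rist_def)
  obtain T' where T': "finite T'" "T' \<subseteq> rist m G v" 
    "rist m G v \<subseteq> (K \<inter> rist m G v) <#>\<^bsub>AutT m\<^esub> T'"
    using group.transversal_Int[OF group_AutT sK rist_subgroup[OF G] RG T(1) _ T(3)] T(2) G_sub
    by auto
  have "subgroup (K \<inter> rist m G v) (AutT m)"
    using group.subgroups_Inter_pair[OF group_AutT sK rist_subgroup[OF G]] .
  then show ?thesis
    using fin_gen_finite_index[OF fin_gen_rist[OF v] RG _ _ T'] by auto
qed

end

section \<open>Virtual retractions\<close>

locale virtual_retraction = branch_group +
  fixes K H :: "(nat list \<Rightarrow> nat list) set" and r :: "(nat list \<Rightarrow> nat list) \<Rightarrow> nat list \<Rightarrow> nat list"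
  assumes K: "finite_index m K G" and H: "subgroup H (AutT m)" and HK: "H \<subseteq> K"
    and r_comp: "x \<in> K \<Longrightarrow> y \<in> K \<Longrightarrow> r (x \<circ> y) = r x \<circ> r y"
    and r_in: "x \<in> K \<Longrightarrow> r x \<in> H" and r_fix: "h \<in> H \<Longrightarrow> r h = h"
begin

lemma K_subgroup: "subgroup K (AutT m)" and KG: "K \<subseteq> G"
  using finite_indexD[OF G K] by auto

lemmas K_closed = subgroup_AutT[OF K_subgroup]
lemmas H_closed = subgroup_AutT[OF H]

lemma r_id: "r id = id"
  using r_fix H_closed(1) by blast

lemma r_pinv:
  assumes x: "x \<in> K" shows "r (pinv x) = pinv (r x)"
proof -
  have "r x \<circ> r (pinv x) = r (x \<circ> pinv x)" "r (pinv x) \<circ> r x = r (pinv x \<circ> x)"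
    using r_comp x K_closed(3)[OF x] by simp_all
  then have "r x \<circ> r (pinv x) = id" "r (pinv x) \<circ> r x = id"
    using comp_pinv[OF K_closed(5)[OF x]] r_id by simp_all
  then show ?thesis by (metis inv_unique_comp)
qed

lemma r_conj:
  assumes "x \<in> K" "n \<in> K" "r n = id"
  shows "r (x \<circ> n \<circ> pinv x) = id"
  using assms K_closed comp_pinv(1)[OF H_closed(5)[OF r_in]] by (simp add: r_comp r_pinv)

text \<open>If \<open>n\<close> moves \<open>u\<close>, then \<open>[[a, n], b] = [a, b]\<close> for \<open>a\<close>, \<open>b\<close> supported below \<open>u\<close>.\<close>

lemma r_commutator:
  assumes n: "n \<in> K" "r n = id" "n u \<noteq> u" "u \<in> verts m"
    and a: "a \<in> K" "a \<in> rist m G u" and b: "b \<in> K" "b \<in> rist m G u"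
  shows "r (a \<circ> b \<circ> pinv a \<circ> pinv b) = id"
proof -
  have nG: "n \<in> G" using n(1) KG by blast
  \<comment> \<open>\<open>c\<close> will be the commutator of \<open>a\<close> and
    \<open>n\<close>, which lies in the kernel of \<open>r\<close> because \<open>n\<close> does.
    Its factor \<open>a'\<close> is supported below \<open>n u\<close>, away from \<open>a\<close>
    and \<open>b\<close>.\<close>
  define a' where "a' = n \<circ> pinv a \<circ> pinv n"
  define c where "c = a \<circ> a'"
  have bij: "bij a" "bij b" "bij n" using a b n K_closed(5) by auto
  have a': "a' \<in> rist m G (n u)"
    unfolding a'_def by (rule rist_conj[OF G nG rist_closed(3)[OF a(2)]])
  have a'K: "a' \<in> K" unfolding a'_def by (intro K_closed(2,3) n(1) a(1))
  have ba': "bij a'" by (rule K_closed(5)[OF a'K])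
  have cK: "c \<in> K" unfolding c_def by (intro K_closed(2) a(1) a'K)
  have comm: "a' \<circ> b = b \<circ> a'"
    using rist_commute[OF G a' b(2)] n(3) tree_aut_length[OF G_closed(4)[OF nG] n(4)] by blast
  have "r a' = pinv (r a)"
    unfolding a'_def using n a K_closed by (simp add: r_comp r_pinv)
  then have rc: "r c = id"
    unfolding c_def using a a'K comp_pinv(1)[OF H_closed(5)[OF r_in[OF a(1)]]] by (simp add: r_comp)
  \<comment> \<open>Since \<open>a'\<close> commutes with \<open>b\<close>, it cancels from the
    commutator of \<open>c\<close> and \<open>b\<close>.\<close>
  have "c \<circ> b \<circ> pinv c \<circ> pinv b = a \<circ> b \<circ> pinv a \<circ> pinv b"
  proof
    fix w
    have "a' (b z) = b (a' z)" for z using comm by (metis comp_apply)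
    then show "(c \<circ> b \<circ> pinv c \<circ> pinv b) w = (a \<circ> b \<circ> pinv a \<circ> pinv b) w"
      unfolding c_def pinv_comp[OF bij(1) ba'] by (simp add: pinv_right[OF ba'])
  qed
  moreover have "r (c \<circ> b \<circ> pinv c \<circ> pinv b) = id"
    using cK b(1) K_closed rc comp_pinv(1)[OF H_closed(5)[OF r_in[OF b(1)]]] by (simp add: r_comp r_pinv)
  ultimately show ?thesis by simp
qed

end

lemma (in branch_group) LR_retraction:
  assumes LR: "LR m G" and H: "subgroup H (AutT m)" "H \<subseteq> G" "fin_gen m H"
  shows "\<exists>K r. virtual_retraction m G K H r"
proof -
  have "virtual_retract m H G"
    using LR H subgroup_AutT_sub_iff[OF G] by (simp add: LR_def)
  then obtain K r where Kr: "finite_index m K G" "H \<subseteq> K"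
    "r \<in> hom ((AutT m)\<lparr>carrier := K\<rparr>) ((AutT m)\<lparr>carrier := H\<rparr>)" "\<forall>h\<in>H. r h = h"
    by (auto simp: virtual_retract_def)
  have "virtual_retraction m G K H r"
  proof (intro virtual_retraction.intro virtual_retraction_axioms.intro)
    show "branch_group m G" by unfold_locales
  qed (use Kr H in \<open>auto simp: hom_def\<close>)
  then show ?thesis by blast
qed

section \<open>Elements of prime order\<close>

text \<open>For \<open>t\<close> of order \<open>p\<close>, \<open>diag t a p\<close> is the product of the conjugates of \<open>a\<close> by
  the powers of \<open>t\<close>; it commutes with \<open>t\<close> when these conjugates commute.\<close>

primrec diag :: "('a \<Rightarrow> 'a) \<Rightarrow> ('a \<Rightarrow> 'a) \<Rightarrow> nat \<Rightarrow> 'a \<Rightarrow> 'a" where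
  "diag t a 0 = id"
| "diag t a (Suc k) = diag t a k \<circ> (t ^^ k \<circ> a \<circ> pinv (t ^^ k))"

text \<open>Primality makes \<open>t\<close> permute the orbit of \<open>v\<close> in one cycle of
  length \<open>p\<close>: a power of \<open>t\<close> fixing \<open>v\<close> is trivial.\<close>

locale prime_order_element = branch_group +
  fixes t :: "nat list \<Rightarrow> nat list" and p :: nat and v :: "nat list"
  assumes t: "t \<in> G" and p: "Factorial_Ring.prime p" and tp: "t ^^ p = id"
    and v: "v \<in> verts m" and tv: "t v \<noteq> v"
begin

abbreviation "R \<equiv> rist m G v"

section \<open>The orbit of \<open>v\<close> under \<open>t\<close>\<close>

lemma t_pow: "t ^^ i \<in> G" "t ^^ i \<in> tree_aut m" "bij (t ^^ i)"
  using G_closed(6)[OF t] G_closed(4,5) by auto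

lemma v_nonempty: "v \<noteq> []"
  using tv G_closed(4)[OF t] by (auto simp: tree_aut_def)

lemma v_orbit: "(t ^^ i) v \<in> verts m" "length ((t ^^ i) v) = length v"
  using tree_aut_verts[OF t_pow(2)] tree_aut_length[OF t_pow(2) v] v by auto

text \<open>If \<open>p\<close> did not divide \<open>i\<close>, Bezout would write \<open>t\<close>
  as a power of \<open>t ^^ i\<close>, and \<open>t\<close> would fix \<open>v\<close> as
  well.\<close>

lemma t_pow_fixes_v:
  assumes "(t ^^ i) v = v" shows "p dvd i"
proof (rule ccontr)
  assume np: "\<not> p dvd i"
  then have c: "coprime p i" using p prime_imp_coprime by blast
  have i0: "i \<noteq> 0" using np by (metis dvd_0_right)
  obtain x y where xy: "i * x = p * y + 1"
    using bezout_nat[OF i0, of p] c by (auto simp: coprime_iff_gcd_eq_1 gcd.commute)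
  have fp: "(f ^^ k) z = z" if "f z = z" for f :: "nat list \<Rightarrow> nat list" and k z
    using that by (induction k) auto
  have "(t ^^ (i * x)) v = v"
    using fp[of "t ^^ i" v x] assms by (simp add: funpow_mult)
  moreover have "(t ^^ (p * y + 1)) v = t v"
  proof -
    have "t ^^ (p * y) = id" using tp by (simp add: funpow_mult[symmetric])
    then show ?thesis by simp
  qed
  ultimately show False using tv xy by metis
qed

lemma t_pow_eq_id: "p dvd i \<Longrightarrow> t ^^ i = id"
  using tp by (auto simp: funpow_mult[symmetric])

lemma t_pow_mod: "t ^^ (i mod p) = t ^^ i"
  using funpow_mod_eq[where f = t and n = p] tp by (auto simp: fun_eq_iff)

lemma orbit_distinct:
  assumes "i < p" "k < p" "i \<noteq> k" shows "(t ^^ i) v \<noteq> (t ^^ k) v"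
proof -
  have *: "(t ^^ i) v \<noteq> (t ^^ k) v" if "i < k" "k < p" for i k
  proof
    assume e: "(t ^^ i) v = (t ^^ k) v"
    have "k = i + (k - i)" using that by simp
    then have "(t ^^ k) v = (t ^^ i) ((t ^^ (k - i)) v)" by (metis comp_apply funpow_add)
    then have "(t ^^ (k - i)) v = v" using e t_pow(3)[of i] by (simp add: bij_is_inj inj_eq)
    then have "p dvd k - i" by (rule t_pow_fixes_v)
    then show False using that by (auto dest: dvd_imp_le)
  qed
  show ?thesis using *[of i k] *[of k i] assms by (metis linorder_neqE_nat)
qed

text \<open>The conjugate of \<open>a\<close> by \<open>t ^^ k\<close> is supported below
  \<open>(t ^^ k) v\<close>, and the subtrees of the orbit are disjoint.\<close>

lemma conj_orbit:
  assumes a: "a \<in> R" and ik: "i < p" "k < p" and w: "w \<in> subtree m v"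
  shows "(t ^^ k \<circ> a \<circ> pinv (t ^^ k)) ((t ^^ i) w) = (if i = k then (t ^^ i) (a w) else (t ^^ i) w)"
proof (cases "i = k")
  case True then show ?thesis by (simp add: pinv_left[OF t_pow(3)])
next
  case False
  have "(t ^^ i) w \<notin> subtree m ((t ^^ k) v)"
    using subtree_disjoint[OF _ orbit_distinct[OF ik False] tree_aut_subtree[OF t_pow(2) w]] v_orbit
    by simp
  then show ?thesis
    using rist_conj[OF G t_pow(1)[of k] a] False by (simp add: rist_G_iff)
qed

section \<open>The diagonal embedding of \<open>R\<close>\<close>

lemma rist_subtree: "a \<in> R \<Longrightarrow> w \<in> subtree m v \<Longrightarrow> a w \<in> subtree m v"
  using bij_supported[of a "subtree m v" w] rist_closed(5) by (auto simp: rist_G_iff)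

lemma diag_orbit:
  assumes a: "a \<in> R" and "i < p" "k \<le> p" and "w \<in> subtree m v"
  shows "diag t a k ((t ^^ i) w) = (if i < k then (t ^^ i) (a w) else (t ^^ i) w)"
  using assms(3,4)
proof (induction k arbitrary: w)
  case (Suc k)
  have e: "diag t a (Suc k) ((t ^^ i) w) =
      diag t a k (if i = k then (t ^^ i) (a w) else (t ^^ i) w)"
    using conj_orbit[OF a assms(2) _ Suc.prems(2), of k] Suc.prems(1) by simp
  show ?case
    using Suc.IH[of w] Suc.IH[of "a w"] Suc.prems rist_subtree[OF a] unfolding e by auto
qed simp

abbreviation "d a \<equiv> diag t a p"

text \<open>Exactly one of the conjugates composing \<open>d a\<close> acts on each subtree of the
  orbit; \<open>i\<close> is reduced modulo \<open>p\<close> to find it. Together with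
  \<open>d_off_orbit\<close> this determines \<open>d a\<close>, so identities between diagonal
  elements are checked along \<open>orbit_cases\<close>.\<close>

lemma d_orbit:
  assumes "a \<in> R" "w \<in> subtree m v"
  shows "d a ((t ^^ i) w) = (t ^^ i) (a w)"
  using diag_orbit[OF assms(1) _ le_refl assms(2), of "i mod p"] prime_gt_0_nat[OF p]
  by (simp add: t_pow_mod)

lemma d_off_orbit:
  assumes "a \<in> R" "\<And>i. w \<notin> subtree m ((t ^^ i) v)"
  shows "d a w = w"
proof -
  have "(t ^^ k \<circ> a \<circ> pinv (t ^^ k)) w = w" for k
    using rist_conj[OF G t_pow(1)[of k] assms(1)] assms(2) by (simp add: rist_G_iff)
  then have "diag t a k w = w" for k by (induction k) auto
  then show ?thesis .
qed

lemma orbit_cases: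
  obtains i w' where "w' \<in> subtree m v" "w = (t ^^ i) w'" | "\<And>i. w \<notin> subtree m ((t ^^ i) v)"
proof (cases "\<exists>i. w \<in> subtree m ((t ^^ i) v)")
  case True
  then obtain i where i: "w \<in> subtree m ((t ^^ i) v)" by blast
  have "pinv (t ^^ i) w \<in> subtree m v"
    using tree_aut_subtree[OF tree_aut_pinv[OF t_pow(2)[of i]] i] by (simp add: pinv_left[OF t_pow(3)])
  then show ?thesis using that(1) pinv_right[OF t_pow(3), of i w] by metis
qed (use that in blast)

lemma d_comp:
  assumes ab: "a \<in> R" "b \<in> R" shows "d (a \<circ> b) = d a \<circ> d b"
proof
  fix w
  have c: "a \<circ> b \<in> R" by (rule rist_closed(2)[OF ab])
  show "d (a \<circ> b) w = (d a \<circ> d b) w"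
  proof (cases w rule: orbit_cases)
    case (1 i w')
    then show ?thesis using ab c rist_subtree by (simp add: d_orbit)
  next
    case 2
    then show ?thesis using ab c by (simp add: d_off_orbit)
  qed
qed

lemma d_id: "d id = id"
proof
  fix w show "d id w = id w"
    by (cases w rule: orbit_cases) (auto simp: d_orbit d_off_orbit rist_closed(1))
qed

lemma d_pinv:
  assumes a: "a \<in> R" shows "d (pinv a) = pinv (d a)"
proof -
  have "d a \<circ> d (pinv a) = id" "d (pinv a) \<circ> d a = id"
    using d_comp[OF a rist_closed(3)[OF a]] d_comp[OF rist_closed(3)[OF a] a]
      comp_pinv[OF rist_closed(5)[OF a]] d_id by simp_all
  then show ?thesis by (metis inv_unique_comp)
qed

lemma d_eq_id:
  assumes a: "a \<in> R" and "d a = id" shows "a = id"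
proof
  fix w show "a w = id w"
    using d_orbit[OF a, of w 0] assms by (cases "w \<in> subtree m v") (auto simp: rist_G_iff)
qed

lemma d_G: assumes a: "a \<in> R" shows "d a \<in> G"
proof -
  have aG: "a \<in> G" using a by (simp add: rist_def)
  have "diag t a k \<in> G" for k
  proof (induction k)
    case (Suc k)
    then show ?case unfolding diag.simps by (intro G_closed(2,3) t_pow(1) aG)
  qed (simp only: diag.simps G_closed(1))
  then show ?thesis .
qed

text \<open>\<open>d a\<close> acts by a copy of \<open>a\<close> on every subtree of the orbit, the
  copies being matched by \<open>t\<close>, and \<open>t\<close> permutes these subtrees, hence also
  their complement.\<close>

lemma d_t: assumes a: "a \<in> R" shows "d a \<circ> t ^^ j = t ^^ j \<circ> d a"
proof
  fix w
  show "(d a \<circ> t ^^ j) w = (t ^^ j \<circ> d a) w"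
  proof (cases w rule: orbit_cases)
    case (1 i w')
    have "(t ^^ j) ((t ^^ i) z) = (t ^^ (j + i)) z" for z by (simp add: funpow_add)
    then show ?thesis using 1 d_orbit[OF a] by simp
  next
    case 2
    have "(t ^^ j) w \<notin> subtree m ((t ^^ i) v)" for i
    proof
      \<comment> \<open>\<open>t ^^ ?k\<close> is the inverse of \<open>t ^^ j\<close>, written with
        a nonnegative exponent.\<close>
      let ?k = "j * (p - 1)"
      assume "(t ^^ j) w \<in> subtree m ((t ^^ i) v)"
      then have "(t ^^ ?k) ((t ^^ j) w) \<in> subtree m ((t ^^ ?k) ((t ^^ i) v))"
        by (rule tree_aut_subtree[OF t_pow(2)])
      moreover have "(t ^^ ?k) ((t ^^ j) w) = (t ^^ (?k + j)) w" by (simp add: funpow_add)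
      moreover have "?k + j = p * j" using prime_gt_0_nat[OF p]
        by (cases p) (auto simp: algebra_simps)
      ultimately have "w \<in> subtree m ((t ^^ (?k + i)) v)"
        using t_pow_eq_id[of "p * j"] by (metis comp_apply dvd_triv_left funpow_add id_apply)
      then show False using 2 by blast
    qed
    then show ?thesis using 2 a by (simp add: d_off_orbit)
  qed
qed

lemma t_pow_pinv: "pinv (t ^^ j) = t ^^ (j * (p - 1))"
proof -
  have e: "j * (p - 1) + j = p * j" "j + j * (p - 1) = p * j" using prime_gt_0_nat[OF p]
    by (cases p; simp add: algebra_simps)+
  have "t ^^ (j * (p - 1)) \<circ> t ^^ j = id" "t ^^ j \<circ> t ^^ (j * (p - 1)) = id"
    unfolding funpow_add[symmetric] e by (simp_all add: t_pow_eq_id)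
  then show ?thesis by (metis inv_unique_comp)
qed

text \<open>Because \<open>d\<close> is multiplicative with values commuting with \<open>t\<close>,
  these products are closed under composition and inversion. They provide a normal form in the group
  generated by \<open>t\<close> and the diagonal.\<close>

lemma d_t_subgroup: "subgroup {d a \<circ> t ^^ j | a j. a \<in> R} (AutT m)"
  unfolding subgroup_AutT_iff
proof (intro conjI ballI)
  let ?Q = "{d a \<circ> t ^^ j | a j. a \<in> R}"
  show "?Q \<subseteq> tree_aut m"
    using G_closed(4)[OF G_closed(2)[OF d_G t_pow(1)]] by auto
  have "id = d id \<circ> t ^^ 0" by (simp add: d_id)
  then show "id \<in> ?Q" using rist_closed(1) by blast
  fix x assume "x \<in> ?Q"
  then obtain a j where a: "a \<in> R" "x = d a \<circ> t ^^ j" by blast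
  show "x \<circ> y \<in> ?Q" if y: "y \<in> ?Q" for y
  proof -
    obtain b k where b: "b \<in> R" "y = d b \<circ> t ^^ k" using y by blast
    have "x \<circ> y = d a \<circ> (t ^^ j \<circ> d b) \<circ> t ^^ k" by (simp add: a b comp_assoc)
    also have "\<dots> = d (a \<circ> b) \<circ> t ^^ (j + k)"
      by (simp add: d_t[OF b(1), symmetric] d_comp[OF a(1) b(1)] funpow_add comp_assoc)
    finally show ?thesis using rist_closed(2)[OF a(1) b(1)] by blast
  qed
  have "pinv x = t ^^ (j * (p - 1)) \<circ> d (pinv a)"
    unfolding a(2) pinv_comp[OF G_closed(5)[OF d_G[OF a(1)]] t_pow(3)]
    by (simp only: d_pinv[OF a(1)] t_pow_pinv)
  also have "\<dots> = d (pinv a) \<circ> t ^^ (j * (p - 1))" by (rule d_t[OF rist_closed(3)[OF a(1)], symmetric])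
  finally show "pinv x \<in> ?Q" using rist_closed(3)[OF a(1)] by blast
qed

lemma not_LR: "\<not> LR m G"
proof
  assume LR: "LR m G"
  obtain S where S: "finite S" "S \<subseteq> R" "generate (AutT m) S = R"
    using fin_gen_rist[OF v v_nonempty] by (auto simp: fin_gen_def)
  \<comment> \<open>Finitely many generators suffice: \<open>d\<close> is a homomorphism on
    \<open>R\<close>, so its values on \<open>S\<close> already produce every
    \<open>d a\<close>.\<close>
  define H where "H = generate (AutT m) (insert t (d ` S))"
  have gens: "insert t (d ` S) \<subseteq> G" using t d_G S(2) by auto
  have HG: "H \<subseteq> G" unfolding H_def by (rule generate_AutT_least[OF gens G])
  have H: "subgroup H (AutT m)"
    unfolding H_def using gens G_sub by (intro generate_AutT_subgroup) auto
  have fgH: "fin_gen m H"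
    using S(1) by (auto simp: fin_gen_def H_def intro!: exI[of _ "insert t (d ` S)"] generate.incl)
  have tH: "t \<in> H" unfolding H_def by (rule generate.incl) simp
  have "insert t (d ` S) \<subseteq> {d a \<circ> t ^^ j | a j. a \<in> R}"
  proof -
    have "t = d id \<circ> t ^^ 1" by (simp add: d_id)
    moreover have "d s = d s \<circ> t ^^ 0" for s by simp
    ultimately show ?thesis using S(2) rist_closed(1) by blast
  qed
  then have H_form: "H \<subseteq> {d a \<circ> t ^^ j | a j. a \<in> R}"
    unfolding H_def by (rule generate_AutT_least[OF _ d_t_subgroup])
  have dH: "d a \<in> H" if "a \<in> R" for a
  proof -
    have "subgroup {a \<in> R. d a \<in> H} (AutT m)"
      unfolding subgroup_AutT_iff
      using rist_closed subgroup_AutT[OF H] by (auto simp: d_id d_comp d_pinv)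
    moreover have "S \<subseteq> {a \<in> R. d a \<in> H}"
      using S(2) by (auto simp: H_def intro: generate.incl)
    ultimately show ?thesis using generate_AutT_least S(3) that by blast
  qed
  obtain K r where "virtual_retraction m G K H r" using LR_retraction[OF LR H HG fgH] by blast
  then interpret virtual_retraction m G K H r .
  have tK: "t ^^ i \<in> K" for i using tH HK K_closed(6) by blast
  \<comment> \<open>If \<open>n\<close> moved \<open>w\<close>, commutators \<open>c\<close> of
    elements of \<open>K\<close> rigid at \<open>w\<close> would lie in the kernel. As
    \<open>t\<close> normalizes the kernel, so would \<open>d c\<close>; but \<open>r\<close> fixes
    \<open>d c\<close>, which forces \<open>c = id\<close>.\<close>
  have ker_below_v: "n w = w" if n: "n \<in> K" "r n = id" and w: "w \<in> subtree m v" for n w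
  proof (rule ccontr)
    assume nw: "n w \<noteq> w"
    have wv: "w \<in> verts m" using w by (simp add: subtree_def)
    obtain a where a: "a \<in> K" "a \<in> rist m G w" "a \<noteq> id"
      using finite_index_rist_nontrivial[OF K wv] by auto
    obtain b where b: "b \<in> K" "b \<in> rist m G w" "a \<circ> b \<noteq> b \<circ> a"
      using rist_not_central[OF K a(2,3)] by auto
    define c where "c = a \<circ> b \<circ> pinv a \<circ> pinv b"
    have rc: "r c = id" unfolding c_def by (rule r_commutator[OF n nw wv a(1,2) b(1,2)])
    have cK: "c \<in> K" unfolding c_def by (intro K_closed(2,3) a(1) b(1))
    have "c \<in> rist m G w" unfolding c_def by (intro rist_closed(2,3) a(2) b(2))
    then have cR: "c \<in> R" using rist_mono[OF w] by blast
    have "diag t c k \<in> K \<and> r (diag t c k) = id" for k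
    proof (induction k)
      case (Suc k)
      have x: "t ^^ k \<circ> c \<circ> pinv (t ^^ k) \<in> K" by (intro K_closed(2,3) tK cK)
      show ?case
        unfolding diag.simps using Suc K_closed(2)[OF _ x] r_comp[OF _ x]
        by (simp only: r_conj[OF tK cK rc] comp_id)
    qed (simp only: diag.simps r_id K_closed(1))
    then have "d c = id" using r_fix[OF dH[OF cR]] by metis
    then have "c = id" by (rule d_eq_id[OF cR])
    then show False
      using b(3) commute_if_commutator_eq_id a(1) b(1) K_closed(5) unfolding c_def by blast
  qed
  \<comment> \<open>The kernel is normalized by \<open>t\<close>, so its triviality spreads from the
    subtree at \<open>v\<close> to those of the whole orbit.\<close>
  have ker_orbit: "n ((t ^^ i) w) = (t ^^ i) w"
    if n: "n \<in> K" "r n = id" and w: "w \<in> subtree m v" for n w i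
  proof -
    let ?x = "pinv (t ^^ i)"
    have x: "?x \<in> K" by (rule K_closed(3)[OF tK])
    have "pinv ?x = t ^^ i" using t_pow(3) by (rule inv_inv_eq)
    then have "(?x \<circ> n \<circ> t ^^ i) w = w"
      using ker_below_v[OF _ r_conj[OF x n] w] K_closed(2) x n(1) tK by simp
    then have "(t ^^ i) (?x (n ((t ^^ i) w))) = (t ^^ i) w" by simp
    then show ?thesis by (simp add: pinv_right[OF t_pow(3)])
  qed
  obtain x where x: "x \<in> K" "x \<in> R" "x \<noteq> id"
    using finite_index_rist_nontrivial[OF K v] by auto
  \<comment> \<open>\<open>n\<close> is the kernel component of \<open>x\<close>. It is trivial
    below the orbit of \<open>v\<close>, which \<open>r x\<close> preserves, so \<open>x\<close> and
    \<open>r x\<close> agree there.\<close>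
  define n where "n = x \<circ> pinv (r x)"
  have rxH: "r x \<in> H" by (rule r_in[OF x(1)])
  have brx: "bij (r x)" by (rule H_closed(5)[OF rxH])
  have nK: "n \<in> K" unfolding n_def using K_closed(2,3) x(1) rxH HK by blast
  have "r (pinv (r x)) = pinv (r x)" using r_fix H_closed(3)[OF rxH] by blast
  then have rn: "r n = id"
    unfolding n_def using r_comp[OF x(1), of "pinv (r x)"] H_closed(3)[OF rxH] HK comp_pinv(1)[OF brx]
    by auto
  have xn: "x z = n (r x z)" for z by (simp add: n_def pinv_left[OF brx])
  obtain a j where aj: "a \<in> R" "r x = d a \<circ> t ^^ j" using H_form rxH by blast
  have av: "a v = v" "x v = v" using rist_fixes_level[OF G _ v] aj(1) x(2) by auto
  \<comment> \<open>Comparing at \<open>v\<close> rules out a nontrivial power of \<open>t\<close>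
    in \<open>r x\<close>.\<close>
  have "x v = n ((t ^^ j) v)"
    using xn[of v] aj d_orbit[OF aj(1) subtree_self[OF v], of j] av by simp
  then have "(t ^^ j) v = v" using ker_orbit[OF nK rn subtree_self[OF v]] av by simp
  then have "t ^^ j = id" by (intro t_pow_eq_id t_pow_fixes_v)
  then have rx: "r x = d a" using aj(2) by simp
  \<comment> \<open>Below \<open>t v\<close> the element \<open>x\<close> is trivial while
    \<open>r x = d a\<close> acts by a copy of \<open>a\<close>, so \<open>a\<close> is trivial
    below \<open>v\<close>; the comparison below \<open>v\<close> itself then makes \<open>x\<close>
    trivial.\<close>
  have a_id: "a w = w" if w: "w \<in> subtree m v" for w
  proof -
    have "t w \<notin> subtree m v"
      using subtree_disjoint[OF _ tv tree_aut_subtree[OF G_closed(4)[OF t] w]] v_orbit(2)[of 1] by simp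
    then have "t w = x (t w)" using x(2) by (simp add: rist_G_iff)
    also have "\<dots> = n (t (a w))" using xn[of "t w"] rx d_orbit[OF aj(1) w, of 1] by simp
    also have "\<dots> = t (a w)" using ker_orbit[OF nK rn rist_subtree[OF aj(1) w], of 1] by simp
    finally show ?thesis using G_closed(5)[OF t] by (simp add: bij_is_inj inj_eq)
  qed
  have "x w = w" for w
  proof (cases "w \<in> subtree m v")
    case True
    then show ?thesis
      using xn[of w] rx d_orbit[OF aj(1) True, of 0] a_id[OF True] ker_below_v[OF nK rn True] by simp
  qed (use x(2) in \<open>simp add: rist_G_iff\<close>)
  then show False using x(3) by auto
qed

end

section \<open>Centralizers and cyclic subgroups\<close>

lemma centralizer_subgroup:
  assumes "Y \<subseteq> tree_aut m"
  shows "subgroup {x \<in> tree_aut m. \<forall>y\<in>Y. x \<circ> y = y \<circ> x} (AutT m)"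
  unfolding subgroup_AutT_iff
proof (intro conjI ballI)
  let ?C = "{x \<in> tree_aut m. \<forall>y\<in>Y. x \<circ> y = y \<circ> x}"
  show "?C \<subseteq> tree_aut m" "id \<in> ?C" using tree_aut_id by auto
  fix x assume x: "x \<in> ?C"
  then have xy: "x (y w) = y (x w)" if "y \<in> Y" for y w
    using that by (auto simp: fun_eq_iff)
  show "x \<circ> z \<in> ?C" if z: "z \<in> ?C" for z
  proof -
    have "z (y w) = y (z w)" if "y \<in> Y" for y w
      using that z by (auto simp: fun_eq_iff)
    then have "x \<circ> z \<circ> y = y \<circ> (x \<circ> z)" if "y \<in> Y" for y
      using that xy by (simp add: fun_eq_iff)
    moreover have "x \<circ> z \<in> tree_aut m" using x z tree_aut_comp by simp
    ultimately show ?thesis by simp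
  qed
  have b: "bij x" using x tree_aut_bij by blast
  have "pinv x \<circ> y = y \<circ> pinv x" if "y \<in> Y" for y
  proof
    fix w
    have "x (y (pinv x w)) = y (x (pinv x w))" using xy[OF that] .
    then have "pinv x (x (y (pinv x w))) = pinv x (y w)" by (simp add: pinv_right[OF b])
    then show "(pinv x \<circ> y) w = (y \<circ> pinv x) w" by (simp add: pinv_left[OF b])
  qed
  then show "pinv x \<in> ?C" using x tree_aut_pinv by blast
qed

text \<open>Two passes through centralizers: every element of the generated group commutes with
  \<open>s\<close>; hence \<open>s\<close> centralizes that group, and so does everything
  \<open>s\<close> generates.\<close>

lemma generate_singleton_commute:
  assumes s: "s \<in> tree_aut m" and x: "x \<in> generate (AutT m) {s}" and y: "y \<in> generate (AutT m) {s}"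
  shows "x \<circ> y = y \<circ> x"
proof -
  let ?H = "generate (AutT m) {s}"
  have Ht: "?H \<subseteq> tree_aut m"
    using generate_AutT_subgroup[of "{s}" m] s by (simp add: subgroup_AutT_iff)
  have "?H \<subseteq> {x \<in> tree_aut m. \<forall>y\<in>{s}. x \<circ> y = y \<circ> x}"
    using s by (intro generate_AutT_least centralizer_subgroup) auto
  then have "?H \<subseteq> {x \<in> tree_aut m. \<forall>y\<in>?H. x \<circ> y = y \<circ> x}"
    using s by (intro generate_AutT_least[OF _ centralizer_subgroup[OF Ht]]) fastforce
  then show ?thesis using x y by blast
qed

section \<open>Fibre products\<close>

locale vertex_pair = branch_group +
  fixes v :: "nat list" and g :: "nat list \<Rightarrow> nat list"
  assumes v: "v \<in> verts m" and g: "g \<in> G" and gv: "g v \<noteq> v"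
begin

abbreviation "R \<equiv> rist m G v"

text \<open>The element with components \<open>a\<close> and \<open>b\<close> in the direct product
  of the rigid stabilizers of \<open>v\<close> and \<open>g v\<close>, the second being identified
  with \<open>R\<close> through conjugation by \<open>g\<close>.\<close>

definition pair :: "(nat list \<Rightarrow> nat list) \<Rightarrow> (nat list \<Rightarrow> nat list) \<Rightarrow> nat list \<Rightarrow> nat list" where
  "pair a b = a \<circ> (g \<circ> b \<circ> pinv g)"

lemma g_bij: "bij g"
  by (rule G_closed(5)[OF g])

lemma R_G: "a \<in> R \<Longrightarrow> a \<in> G"
  by (simp add: rist_def)

lemma pair_G: "a \<in> R \<Longrightarrow> b \<in> R \<Longrightarrow> pair a b \<in> G"
  unfolding pair_def by (intro G_closed(2,3) R_G g)

lemma pair_id: "pair a id = a"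
  by (simp add: pair_def comp_pinv(1)[OF g_bij])

lemma pair_comp:
  assumes "b \<in> R" "a' \<in> R"
  shows "pair a b \<circ> pair a' b' = pair (a \<circ> a') (b \<circ> b')"
proof
  fix w
  have "(g \<circ> b \<circ> pinv g) \<circ> a' = a' \<circ> (g \<circ> b \<circ> pinv g)"
    using rist_commute[OF G rist_conj[OF G g assms(1)] assms(2)] gv
      tree_aut_length[OF G_closed(4)[OF g] v] by blast
  then have "g (b (pinv g (a' z))) = a' (g (b (pinv g z)))" for z
    by (metis comp_apply)
  then show "(pair a b \<circ> pair a' b') w = pair (a \<circ> a') (b \<circ> b') w"
    by (simp add: pair_def pinv_left[OF g_bij])
qed

lemma pair_pinv:
  assumes "a \<in> R" "b \<in> R"
  shows "pinv (pair a b) = pair (pinv a) (pinv b)"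
proof -
  have "pair a b \<circ> pair (pinv a) (pinv b) = id" "pair (pinv a) (pinv b) \<circ> pair a b = id"
    using assms rist_closed(3) pair_id[of id]
    by (simp_all add: pair_comp comp_pinv[OF rist_closed(5)[OF assms(1)]] comp_pinv[OF rist_closed(5)[OF assms(2)]])
  then show ?thesis by (metis inv_unique_comp)
qed

text \<open>Below \<open>v\<close> only the first component acts, which determines it; cancelling it
  leaves the conjugate of the second.\<close>

lemma pair_inj:
  assumes R: "a \<in> R" "b \<in> R" "a' \<in> R" "b' \<in> R" and e: "pair a b = pair a' b'"
  shows "a = a' \<and> b = b'"
proof
  have off: "(g \<circ> b \<circ> pinv g) w = w" if "w \<in> subtree m v" "b \<in> R" for b w
  proof -
    have "w \<notin> subtree m (g v)"
      using subtree_disjoint[of v "g v"] that gv tree_aut_length[OF G_closed(4)[OF g] v] by auto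
    then show ?thesis using rist_conj[OF G g that(2)] by (simp add: rist_G_iff)
  qed
  show a: "a = a'"
  proof
    fix w show "a w = a' w"
    proof (cases "w \<in> subtree m v")
      case True
      then show ?thesis using fun_cong[OF e, of w] off[OF True R(2)] off[OF True R(4)]
        by (simp add: pair_def)
    qed (use R in \<open>simp add: rist_G_iff\<close>)
  qed
  show "b = b'"
  proof
    fix w
    have "a (g (b w)) = a (g (b' w))"
      using fun_cong[OF e, of "g w"] a by (simp add: pair_def pinv_left[OF g_bij])
    then show "b w = b' w" using rist_closed(5)[OF R(1)] g_bij by (simp add: bij_is_inj inj_eq)
  qed
qed

lemma fiber_product_subgroup:
  assumes A: "subgroup A (AutT m)" "A \<subseteq> R"
    and \<rho>: "\<And>x y. x \<in> A \<Longrightarrow> y \<in> A \<Longrightarrow> \<rho> (x \<circ> y) = \<rho> x \<circ> \<rho> y"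
      "\<And>x. x \<in> A \<Longrightarrow> \<rho> (pinv x) = pinv (\<rho> x)"
  shows "subgroup {pair a b | a b. a \<in> A \<and> b \<in> A \<and> \<rho> a = \<rho> b} (AutT m)"
  unfolding subgroup_AutT_iff
proof (intro conjI ballI)
  let ?Q = "{pair a b | a b. a \<in> A \<and> b \<in> A \<and> \<rho> a = \<rho> b}"
  note Ac = subgroup_AutT[OF A(1)]
  show "?Q \<subseteq> tree_aut m" using G_closed(4)[OF pair_G] A(2) by blast
  show "id \<in> ?Q" using pair_id[of id] Ac(1) by (metis (mono_tags, lifting) mem_Collect_eq)
  fix x assume "x \<in> ?Q"
  then obtain a b where ab: "a \<in> A" "b \<in> A" "\<rho> a = \<rho> b" "x = pair a b" by blast
  show "x \<circ> y \<in> ?Q" if y: "y \<in> ?Q" for y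
  proof -
    obtain a' b' where ab': "a' \<in> A" "b' \<in> A" "\<rho> a' = \<rho> b'" "y = pair a' b'" using y by blast
    have "x \<circ> y = pair (a \<circ> a') (b \<circ> b')" using pair_comp ab ab' A(2) by blast
    moreover have "\<rho> (a \<circ> a') = \<rho> (b \<circ> b')" using \<rho>(1) ab ab' by simp
    ultimately show ?thesis using Ac(2) ab ab' by blast
  qed
  have "pinv x = pair (pinv a) (pinv b)" using pair_pinv ab A(2) by blast
  moreover have "\<rho> (pinv a) = \<rho> (pinv b)" using \<rho>(2) ab by simp
  ultimately show "pinv x \<in> ?Q" using Ac(3) ab by blast
qed

text \<open>Since \<open>\<rho>\<close> is an idempotent endomorphism of \<open>A\<close>, the fibre product is generated by the
  elements \<open>pair a (\<rho> a)\<close> and \<open>pair (\<rho> a) a\<close>: with \<open>z = \<rho> a = \<rho> b\<close>,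
  \<open>(a, b) = (a, z) (z, z)\<^sup>-\<^sup>1 (z, b)\<close>.\<close>

lemma fiber_product_fin_gen:
  assumes A: "subgroup A (AutT m)" "A \<subseteq> R" "fin_gen m A"
    and \<rho>: "\<And>x y. x \<in> A \<Longrightarrow> y \<in> A \<Longrightarrow> \<rho> (x \<circ> y) = \<rho> x \<circ> \<rho> y"
      "\<And>x. x \<in> A \<Longrightarrow> \<rho> (pinv x) = pinv (\<rho> x)"
    and \<rho>A: "\<And>x. x \<in> A \<Longrightarrow> \<rho> x \<in> A" "\<And>x. x \<in> A \<Longrightarrow> \<rho> (\<rho> x) = \<rho> x"
  shows "fin_gen m {pair a b | a b. a \<in> A \<and> b \<in> A \<and> \<rho> a = \<rho> b}" (is "fin_gen m ?Q")
proof -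
  note Ac = subgroup_AutT[OF A(1)]
  note Q = fiber_product_subgroup[OF A(1,2) \<rho>]
  obtain S where S: "finite S" "S \<subseteq> A" "generate (AutT m) S = A"
    using A(3) by (auto simp: fin_gen_def)
  define W where "W = (\<lambda>x. pair x (\<rho> x)) ` S \<union> (\<lambda>x. pair (\<rho> x) x) ` S"
  let ?W = "generate (AutT m) W"
  have WQ: "W \<subseteq> ?Q" using S(2) \<rho>A by (fastforce simp: W_def)
  have "W \<subseteq> tree_aut m" using WQ Q by (auto simp: subgroup_AutT_iff)
  then have sW: "subgroup ?W (AutT m)" by (rule generate_AutT_subgroup)
  note Wc = subgroup_AutT[OF sW]
  \<comment> \<open>\<open>\<rho> id\<close> is an idempotent bijection, hence the identity.\<close>
  have \<rho>id: "\<rho> id = id"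
  proof -
    have b: "bij (\<rho> id)" using \<rho>A(1) Ac by blast
    have "\<rho> id \<circ> \<rho> id = \<rho> id" using \<rho>(1)[OF Ac(1) Ac(1)] by simp
    then have "\<rho> id (\<rho> id z) = \<rho> id z" for z by (metis comp_apply)
    then have "\<rho> id z = z" for z using b by (metis bij_is_inj inj_eq)
    then show ?thesis by auto
  qed
  \<comment> \<open>By multiplicativity of \<open>\<rho>\<close>, the \<open>a\<close> with
    \<open>pair a (\<rho> a)\<close> in \<open>?W\<close> form a subgroup, and it contains
    \<open>S\<close>. The next claim is the mirror image.\<close>
  have 1: "pair a (\<rho> a) \<in> ?W" if "a \<in> A" for a
  proof -
    have "subgroup {a \<in> A. pair a (\<rho> a) \<in> ?W} (AutT m)"
      unfolding subgroup_AutT_iff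
    proof (intro conjI ballI)
      show "{a \<in> A. pair a (\<rho> a) \<in> ?W} \<subseteq> tree_aut m" using Ac(4) by blast
      show "id \<in> {a \<in> A. pair a (\<rho> a) \<in> ?W}" using Ac(1) Wc(1) \<rho>id pair_id by simp
      fix x assume x: "x \<in> {a \<in> A. pair a (\<rho> a) \<in> ?W}"
      show "x \<circ> y \<in> {a \<in> A. pair a (\<rho> a) \<in> ?W}" if y: "y \<in> {a \<in> A. pair a (\<rho> a) \<in> ?W}" for y
      proof -
        have "pair (x \<circ> y) (\<rho> (x \<circ> y)) = pair x (\<rho> x) \<circ> pair y (\<rho> y)"
          using x y \<rho>(1) \<rho>A(1) A(2) by (subst pair_comp) auto
        then show ?thesis using x y Ac(2) Wc(2) by simp
      qed
      have "pair (pinv x) (\<rho> (pinv x)) = pinv (pair x (\<rho> x))"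
        using x \<rho>(2) \<rho>A(1) A(2) by (subst pair_pinv) auto
      then show "pinv x \<in> {a \<in> A. pair a (\<rho> a) \<in> ?W}" using x Ac(3) Wc(3) by simp
    qed
    moreover have "S \<subseteq> {a \<in> A. pair a (\<rho> a) \<in> ?W}"
      using S(2) by (auto simp: W_def intro!: generate.incl)
    ultimately show ?thesis using generate_AutT_least S(3) that by blast
  qed
  have 2: "pair (\<rho> a) a \<in> ?W" if "a \<in> A" for a
  proof -
    have "subgroup {a \<in> A. pair (\<rho> a) a \<in> ?W} (AutT m)"
      unfolding subgroup_AutT_iff
    proof (intro conjI ballI)
      show "{a \<in> A. pair (\<rho> a) a \<in> ?W} \<subseteq> tree_aut m" using Ac(4) by blast
      show "id \<in> {a \<in> A. pair (\<rho> a) a \<in> ?W}" using Ac(1) Wc(1) \<rho>id pair_id by simp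
      fix x assume x: "x \<in> {a \<in> A. pair (\<rho> a) a \<in> ?W}"
      show "x \<circ> y \<in> {a \<in> A. pair (\<rho> a) a \<in> ?W}" if y: "y \<in> {a \<in> A. pair (\<rho> a) a \<in> ?W}" for y
      proof -
        have "pair (\<rho> (x \<circ> y)) (x \<circ> y) = pair (\<rho> x) x \<circ> pair (\<rho> y) y"
          using x y \<rho>(1) \<rho>A(1) A(2) by (subst pair_comp) auto
        then show ?thesis using x y Ac(2) Wc(2) by simp
      qed
      have "pair (\<rho> (pinv x)) (pinv x) = pinv (pair (\<rho> x) x)"
        using x \<rho>(2) \<rho>A(1) A(2) by (subst pair_pinv) auto
      then show "pinv x \<in> {a \<in> A. pair (\<rho> a) a \<in> ?W}" using x Ac(3) Wc(3) by simp
    qed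
    moreover have "S \<subseteq> {a \<in> A. pair (\<rho> a) a \<in> ?W}"
      using S(2) by (auto simp: W_def intro!: generate.incl)
    ultimately show ?thesis using generate_AutT_least S(3) that by blast
  qed
  have "?Q \<subseteq> ?W"
  proof
    fix x assume "x \<in> ?Q"
    then obtain a b where ab: "a \<in> A" "b \<in> A" "\<rho> a = \<rho> b" "x = pair a b" by blast
    define z where "z = \<rho> a"
    have zA: "z \<in> A" using \<rho>A(1) ab by (simp add: z_def)
    have zz: "\<rho> z = z" using \<rho>A(2) ab by (simp add: z_def)
    have bz: "bij z" by (rule Ac(5)[OF zA])
    have R: "a \<in> R" "b \<in> R" "z \<in> R" "pinv z \<in> R" using ab zA A(2) rist_closed(3) by auto
    have "pair a z \<circ> pinv (pair z z) \<circ> pair z b = pair (a \<circ> pinv z \<circ> z) (z \<circ> pinv z \<circ> b)"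
      using R rist_closed(2) by (simp add: pair_pinv pair_comp)
    also have "\<dots> = x" using ab(4) comp_pinv[OF bz] by (simp add: comp_assoc)
    finally have "x = pair a z \<circ> pinv (pair z z) \<circ> pair z b" by simp
    moreover have "pair a z \<in> ?W" "pair z b \<in> ?W" "pair z z \<in> ?W"
      using 1[OF ab(1)] 2[OF ab(2)] 1[OF zA] ab(3) zz by (simp_all add: z_def)
    ultimately show "x \<in> ?W" using Wc(2,3) by simp
  qed
  moreover have "?W \<subseteq> ?Q" by (rule generate_AutT_least[OF WQ Q])
  ultimately have "?W = ?Q" by blast
  moreover have "finite W" using S(1) by (simp add: W_def)
  ultimately show ?thesis using WQ unfolding fin_gen_def by blast
qed

text \<open>Two retractions are used: \<open>r\<close> onto the cyclic group of \<open>s\<close>,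
  and \<open>r'\<close> onto the fibre product \<open>Q\<close> of two copies of \<open>A\<close>
  over \<open>r\<close>. A positive power of \<open>s\<close> turns out to be a member of
  \<open>Q\<close> with trivial second component, so \<open>r\<close> kills it; but \<open>r\<close>
  also fixes it.\<close>

lemma LR_imp_torsion:
  assumes LR: "LR m G" and s: "s \<in> R"
  shows "\<exists>k>0. s ^^ k = id"
proof -
  have v0: "v \<noteq> []" using gv G_closed(4)[OF g] by (auto simp: tree_aut_def)
  have sT: "s \<in> tree_aut m" by (rule rist_closed(4)[OF s])
  define H where "H = generate (AutT m) {s}"
  have sH: "s \<in> H" unfolding H_def by (rule generate.incl) simp
  have H: "subgroup H (AutT m)" unfolding H_def using sT by (intro generate_AutT_subgroup) simp
  have HR: "H \<subseteq> R" unfolding H_def using s by (intro generate_AutT_least rist_subgroup[OF G]) simp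
  have fgH: "fin_gen m H" using sH by (auto simp: fin_gen_def H_def intro!: exI[of _ "{s}"])
  have HG: "H \<subseteq> G" using HR R_G by blast
  obtain K r where "virtual_retraction m G K H r" using LR_retraction[OF LR H HG fgH] by blast
  then interpret r: virtual_retraction m G K H r .
  define A where "A = K \<inter> R"
  have A: "subgroup A (AutT m)"
    unfolding A_def using group.subgroups_Inter_pair[OF group_AutT r.K_subgroup rist_subgroup[OF G]] .
  note Ac = subgroup_AutT[OF A]
  have AR: "A \<subseteq> R" and AK: "A \<subseteq> K" by (auto simp: A_def)
  have HA: "H \<subseteq> A" using HR r.HK by (auto simp: A_def)
  have fgA: "fin_gen m A" unfolding A_def by (rule fin_gen_Int_rist[OF v v0 r.K])
  have rA: "r x \<in> A" "r (r x) = r x" "r (pinv x) = pinv (r x)" if "x \<in> A" for x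
    using that AK r.r_in r.r_fix r.r_pinv HA by blast+
  have rc: "r (x \<circ> y) = r x \<circ> r y" if "x \<in> A" "y \<in> A" for x y using that AK r.r_comp by blast
  \<comment> \<open>The values of \<open>r\<close> lie in a cyclic group, so \<open>r\<close> is
    invariant under conjugation by \<open>A\<close>; this makes \<open>Q\<close> normal among the
    pairs over \<open>A\<close>.\<close>
  have r_conj: "r (a \<circ> x \<circ> pinv a) = r x" if ax: "a \<in> A" "x \<in> A" for a x
  proof -
    have h: "r a \<in> H" "r x \<in> H" using ax AK r.r_in by auto
    have "r a \<circ> r x = r x \<circ> r a"
      using generate_singleton_commute[OF sT] h unfolding H_def by blast
    then have "r a \<circ> r x \<circ> pinv (r a) = r x"
      using comp_pinv(1)[OF r.H_closed(5)[OF h(1)]] by (simp add: comp_assoc)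
    then show ?thesis using ax Ac(2,3) by (simp add: rc rA)
  qed
  define Q where "Q = {pair a b | a b. a \<in> A \<and> b \<in> A \<and> r a = r b}"
  have Q: "subgroup Q (AutT m)"
    unfolding Q_def by (rule fiber_product_subgroup[OF A AR rc rA(3)])
  have fgQ: "fin_gen m Q"
    unfolding Q_def by (rule fiber_product_fin_gen[OF A AR fgA rc rA(3) rA(1,2)])
  have QG: "Q \<subseteq> G" using pair_G AR by (auto simp: Q_def)
  obtain K' r' where "virtual_retraction m G K' Q r'" using LR_retraction[OF LR Q QG fgQ] by blast
  then interpret q: virtual_retraction m G K' Q r' .
  \<comment> \<open>A kernel element \<open>?n\<close> normalizes \<open>Q\<close>. Applying
    \<open>r'\<close> to the conjugate of \<open>?h\<close> by \<open>?n\<close>, which lies in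
    \<open>Q\<close>, returns \<open>?h\<close>; hence \<open>?n\<close> centralizes
    \<open>Q\<close>.\<close>
  have ker_triv: "a = id \<and> b = id"
    if ab: "a \<in> A" "b \<in> A" and n: "pair a b \<in> K'" "r' (pair a b) = id" for a b
  proof -
    have commute: "a \<circ> x = x \<circ> a \<and> b \<circ> y = y \<circ> b" if xy: "x \<in> A" "y \<in> A" "r x = r y" for x y
    proof -
      let ?n = "pair a b" and ?h = "pair x y"
      have R: "a \<in> R" "b \<in> R" "x \<in> R" "y \<in> R" using ab xy AR by auto
      have hQ: "?h \<in> Q" using xy by (auto simp: Q_def)
      have hK: "?h \<in> K'" using hQ q.HK by blast
      have e: "?n \<circ> ?h \<circ> pinv ?n = pair (a \<circ> x \<circ> pinv a) (b \<circ> y \<circ> pinv b)"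
        using R rist_closed(2,3) by (simp add: pair_pinv pair_comp)
      have cA: "a \<circ> x \<circ> pinv a \<in> A" "b \<circ> y \<circ> pinv b \<in> A" using ab xy Ac(2,3) by auto
      have "r (a \<circ> x \<circ> pinv a) = r (b \<circ> y \<circ> pinv b)" using r_conj ab xy by simp
      then have cQ: "?n \<circ> ?h \<circ> pinv ?n \<in> Q" unfolding e using cA by (auto simp: Q_def)
      have "?n \<circ> ?h \<circ> pinv ?n = r' (?n \<circ> ?h \<circ> pinv ?n)" using q.r_fix[OF cQ] by simp
      also have "\<dots> = r' ?n \<circ> r' ?h \<circ> pinv (r' ?n)"
        using n hK q.K_closed(2,3) by (simp only: q.r_comp q.r_pinv)
      also have "\<dots> = ?h" using n(2) q.r_fix[OF hQ] by simp
      finally have "pair (a \<circ> x \<circ> pinv a) (b \<circ> y \<circ> pinv b) = pair x y" unfolding e .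
      then have ee: "a \<circ> x \<circ> pinv a = x" "b \<circ> y \<circ> pinv b = y"
        using pair_inj[of "a \<circ> x \<circ> pinv a" "b \<circ> y \<circ> pinv b" x y] cA R AR by auto
      have "a \<circ> x \<circ> pinv a \<circ> a = x \<circ> a" "b \<circ> y \<circ> pinv b \<circ> b = y \<circ> b" unfolding ee by simp_all
      then show ?thesis
        using comp_pinv(2)[OF rist_closed(5)[OF R(1)]] comp_pinv(2)[OF rist_closed(5)[OF R(2)]]
        by (simp add: comp_assoc)
    qed
    have "z = id" if z: "z \<in> A" "\<And>x. x \<in> A \<Longrightarrow> z \<circ> x = x \<circ> z" for z
    proof (rule ccontr)
      assume "z \<noteq> id"
      then obtain x where "x \<in> K \<inter> R" "z \<circ> x \<noteq> x \<circ> z"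
        using rist_not_central[OF r.K _ \<open>z \<noteq> id\<close>] z(1) AR by blast
      then show False using z(2) by (simp add: A_def)
    qed
    \<comment> \<open>\<open>pair x (r x)\<close> and \<open>pair (r x) x\<close> lie in
      \<open>Q\<close> for all \<open>x \<in> A\<close>, so \<open>a\<close> and \<open>b\<close>
      are central in \<open>A\<close>, whose centre is trivial.\<close>
    then show ?thesis using commute rA(1,2) ab by metis
  qed
  have sG: "s ^^ i \<in> G" for i using G_closed(6) R_G[OF s] by blast
  \<comment> \<open>Pigeonhole on the powers of \<open>s\<close>: the positive power
    \<open>s ^^ (j - i)\<close> lies in \<open>K'\<close>.\<close>
  obtain i j where ij: "i < j" "s ^^ j \<circ> pinv (s ^^ i) \<in> K'"
    using finite_index_pigeonhole[OF G q.K sG] by blast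
  define x where "x = s ^^ (j - i)"
  have "s ^^ j = x \<circ> s ^^ i" unfolding x_def funpow_add[symmetric] using ij(1) by simp
  then have "s ^^ j \<circ> pinv (s ^^ i) = x"
    using comp_pinv(1)[OF G_closed(5)[OF sG]] by (simp add: comp_assoc)
  then have xK: "x \<in> K'" using ij(2) by simp
  have xH: "x \<in> H" unfolding x_def by (rule r.H_closed(6)[OF sH])
  have xA: "x \<in> A" using xH HA by blast
  have rxQ: "r' x \<in> Q" by (rule q.r_in[OF xK])
  then obtain a b where ab: "a \<in> A" "b \<in> A" "r a = r b" "r' x = pair a b" by (auto simp: Q_def)
  have iA: "x \<circ> pinv a \<in> A" "pinv b \<in> A" using xA ab Ac(2,3) by auto
  \<comment> \<open>The kernel component of \<open>x\<close> is again a pair over \<open>A\<close>,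
    hence trivial by \<open>ker_triv\<close>. Comparing components gives \<open>x = a\<close> and
    \<open>b = id\<close>.\<close>
  have "x \<circ> pinv (r' x) = pair x id \<circ> pair (pinv a) (pinv b)"
    using ab(1,2,4) AR by (simp add: pair_id pair_pinv subset_iff)
  also have "\<dots> = pair (x \<circ> pinv a) (pinv b)"
    using pair_comp[of id "pinv a" x "pinv b"] rist_closed(1,3) ab AR by auto
  finally have n: "x \<circ> pinv (r' x) = pair (x \<circ> pinv a) (pinv b)" .
  have pK: "pinv (r' x) \<in> K'" and pf: "r' (pinv (r' x)) = pinv (r' x)"
    using q.HK q.r_fix q.H_closed(3)[OF rxQ] by auto
  have nK: "x \<circ> pinv (r' x) \<in> K'" by (rule q.K_closed(2)[OF xK pK])
  have rn: "r' (x \<circ> pinv (r' x)) = id"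
    unfolding q.r_comp[OF xK pK] pf by (rule comp_pinv(1)[OF q.H_closed(5)[OF rxQ]])
  have "x \<circ> pinv a = id \<and> pinv b = id"
    using ker_triv[OF iA] nK rn unfolding n by blast
  then have xa: "x \<circ> pinv a = id" and pb: "pinv b = id" by auto
  have "x = x \<circ> pinv a \<circ> a" using comp_pinv(2)[OF Ac(5)[OF ab(1)]] by (simp add: comp_assoc)
  then have "x = a" using xa by simp
  moreover have "b = id" using comp_pinv(1)[OF Ac(5)[OF ab(2)]] pb by simp
  ultimately have "x = id" using ab(3) r.r_fix[OF xH] r.r_id by simp
  then show ?thesis using ij(1) by (auto simp: x_def intro!: exI[of _ "j - i"])
qed

end

text \<open>With \<open>n\<close> the exact order of \<open>x\<close> and \<open>p\<close> a prime
  factor of it, \<open>x ^^ (n div p)\<close> has order \<open>p\<close>; any word it moves is a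
  vertex.\<close>

lemma (in branch_group) prime_order_element_exists:
  assumes x: "x \<in> G" "x \<noteq> id" and k: "k > 0" "x ^^ k = id"
  shows "\<exists>t p v. prime_order_element m G t p v"
proof -
  define n where "n = (LEAST n. n > 0 \<and> x ^^ n = id)"
  have n: "n > 0" "x ^^ n = id"
    using LeastI[of "\<lambda>n. n > 0 \<and> x ^^ n = id" k] k by (auto simp: n_def)
  have least: "x ^^ i \<noteq> id" if "0 < i" "i < n" for i
    using not_less_Least[of i "\<lambda>n. n > 0 \<and> x ^^ n = id"] that by (auto simp: n_def)
  have "n \<noteq> 1" using n(2) x(2) by auto
  then obtain p where p: "Factorial_Ring.prime p" "p dvd n" using prime_factor_nat by blast
  define t where "t = x ^^ (n div p)"
  have "t ^^ p = id" unfolding t_def funpow_mult using p(2) n(2) by (simp add: mult.commute)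
  moreover have "t \<noteq> id" unfolding t_def
  proof (rule least)
    show "0 < n div p" using p(2) n(1) by (auto elim!: dvdE)
    show "n div p < n" using n(1) prime_gt_1_nat[OF p(1)] by simp
  qed
  then obtain w where w: "t w \<noteq> w" by (auto simp: fun_eq_iff)
  have tG: "t \<in> G" unfolding t_def by (rule G_closed(6)[OF x(1)])
  moreover have "w \<in> verts m" using w G_closed(4)[OF tG] by (auto simp: tree_aut_def)
  ultimately have "prime_order_element m G t p w"
    by unfold_locales (use w p in auto)
  then show ?thesis by blast
qed

theorem theoremA:
  fixes m :: "nat \<Rightarrow> nat" and G :: "(nat list \<Rightarrow> nat list) set"
  assumes "\<forall>n. m n \<ge> 2"
    and "subgroup G (AutT m)"
    and "fin_gen m G"
    and "branch m G"
  shows "\<not> LR m G"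
proof
  assume LR: "LR m G"
  interpret branch_group m G 
    using assms by (intro branch_group.intro) blast+
  have V: "[0] \<in> verts m" "[1] \<in> verts m"
    using m2[of 0] by (auto simp: verts_def)
  obtain g where g: "g \<in> G" "g [0] = [1]" using transitive[OF V] by auto
  then interpret vertex_pair m G "[0]" g by unfold_locales (use V in auto)
  obtain s where s: "s \<in> rist m G [0]" "s \<noteq> id" using rist_nontrivial[OF V(1)] by auto
  obtain k where "k > 0" "s ^^ k = id" using LR_imp_torsion[OF LR s(1)] by blast
  then obtain t p v where "prime_order_element m G t p v"
    using prime_order_element_exists[OF R_G[OF s(1)] s(2)] by blast
  then show False using prime_order_element.not_LR LR by blast
qed

end
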